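(* Let $n\geq2$, let $\gamma$ be an invertible (biholomorphic) contraction of $\mathbb C^n$ at $0$, let $\beta=(\beta_1,\dots,\beta_n)$ be the collection of eigenvalues of $d_0\gamma$, and let $r$ be the maximal length of the resonances of $\beta$. Then there exists a global biholomorphism $\phi:\mathbb C^n\to\mathbb C^n$ such that $\phi^{-1}\gamma\phi$ is an element of the group $G^r_\beta$ of $\beta$ sub-resonant polynomial transformations of $\mathbb C^n$.
   Context: A biholomorphic contraction at $0$ is a biholomorphism $\gamma:\mathbb C^n\to\mathbb C^n$ such that for every compact $K$ and every neighborhood $U$ of $0$, $\gamma^N(K)\subset U$ for all sufficiently large $N$. The eigenvalues of $d_0\gamma$, listed with multiplicity, are ordered so that $1>|\beta_1|\geq\dots\geq|\beta_n|>0$ and equal eigenvalues are consecutive. For $p\in\mathbb N^n$ put $\beta^p=\prod_l\beta_l^{p_l}$, $|p|=\sum_l p_l$. Maximal length of resonances: $r=\max\{|p| : p\in\mathbb N^n,\ \exists j,\ \beta_j=\beta^p\}$ (finite). Let $e_1,\dots,e_n$ be the standard basis of $\mathbb Z^n$, $\mathcal P_j=\{p\in\mathbb N^n : \beta_j=\beta^p \text{ and } p\neq e_k\text{ for all }k\geq j\}$, $\mathcal Q_j=\{q\in\mathbb N^n\setminus\{0\} : \exists p\in\mathcal P_j,\ q_l\leq p_l\text{ for all }l\}$ (elements of $\mathcal Q_j$ only involve the indices $1,\dots,j-1$). $G^r_\beta$ is the set of polynomial maps $P:\mathbb C^n\to\mathbb C^n$ of the form $P(z)=(a_1z_1,a_2z_2+P_2(z_1),\dots,a_nz_n+P_n(z_1,\dots,z_{n-1}))$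 with all $a_j\neq0$ and $P_j=\sum_{q\in\mathcal Q_j}c_{j,q}z^q$, $c_{j,q}\in\mathbb C$. *)

theory Defs
  imports "HOL-Analysis.Analysis" "HOL-Computational_Algebra.Polynomial"
begin

text \<open>
  Complex \<open>n\<close>-space is \<^typ>\<open>complex^'n\<close>, with an index type \<open>'n\<close> that is finite and linearly
  ordered, i.e. uniquely order-isomorphic to \<open>{1,\<dots>,n}\<close> for \<open>n = CARD('n)\<close>. The order is needed
  because the normal forms below are triangular. Multi-indices are elements of \<^typ>\<open>nat^'n\<close>,
  with \<open>axis k 1\<close> the \<open>k\<close>-th unit multi-index.
\<close>

type_synonym 'n cvec = "(complex, 'n) vec"
type_synonym 'n multi_index = "(nat, 'n) vec"

section \<open>Biholomorphic contractions\<close>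

text \<open>
  In \<^const>\<open>has_derivative\<close> the derivative is only real linear; holomorphy in several variables
  asks for it to be complex linear.
\<close>

definition holomorphic_map :: "(complex^'n \<Rightarrow> complex^'m) \<Rightarrow> bool" where
  "holomorphic_map f \<longleftrightarrow>
     (\<forall>z. \<exists>f'. Vector_Spaces.linear (*s) (*s) f' \<and> (f has_derivative f') (at z))"

definition biholomorphism :: "(complex^'n \<Rightarrow> complex^'n) \<Rightarrow> bool" where
  "biholomorphism f \<longleftrightarrow> bij f \<and> holomorphic_map f \<and> holomorphic_map (inv f)"

definition biholomorphic_contraction :: "(complex^'n \<Rightarrow> complex^'n) \<Rightarrow> bool" where
  "biholomorphic_contraction \<gamma> \<longleftrightarrow> biholomorphism \<gamma> \<and>
     (\<forall>K U. compact K \<and> open U \<and> 0 \<in> U \<longrightarrow> (\<forall>\<^sub>F N in sequentially. (\<gamma> ^^ N) ` K \<subseteq> U))"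

section \<open>Eigenvalues of the differential at the origin\<close>

definition differential_at_0 :: "(complex^'n \<Rightarrow> complex^'n) \<Rightarrow> complex^'n^'n" where
  "differential_at_0 \<gamma> = matrix (frechet_derivative \<gamma> (at 0))"

definition charpoly :: "complex^'n^'n \<Rightarrow> complex poly" where
  "charpoly A = det (mat [:0, 1:] - (\<chi> i j. [:A $ i $ j:]))"

text \<open>
  \<open>\<beta>\<close> lists the eigenvalues of \<open>A\<close> with algebraic multiplicity, by non-increasing modulus and
  with equal eigenvalues consecutive. The bounds \<open>0 < cmod (\<beta> $ j) < 1\<close> are not required here:
  they follow when \<open>A\<close> is the differential at \<open>0\<close> of a biholomorphic contraction.
\<close>

definition ordered_eigenvalues :: "('n::{finite,linorder} cvec, 'n) vec \<Rightarrow> 'n cvec \<Rightarrow> bool" where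
  "ordered_eigenvalues A \<beta> \<longleftrightarrow>
     charpoly A = (\<Prod>j\<in>UNIV. [:- (\<beta> $ j), 1:]) \<and>
     (\<forall>i j. i \<le> j \<longrightarrow> cmod (\<beta> $ j) \<le> cmod (\<beta> $ i)) \<and>
     (\<forall>i j k. i \<le> k \<and> k \<le> j \<and> \<beta> $ i = \<beta> $ j \<longrightarrow> \<beta> $ k = \<beta> $ i)"

section \<open>Resonances and sub-resonant polynomial maps\<close>

definition mono_pow :: "complex^'n \<Rightarrow> nat^'n \<Rightarrow> complex" where
  "mono_pow z p = (\<Prod>l\<in>UNIV. (z $ l) ^ (p $ l))"

definition mi_length :: "nat^'n \<Rightarrow> nat" where
  "mi_length p = (\<Sum>l\<in>UNIV. p $ l)"

definition max_resonance_length :: "complex^'n \<Rightarrow> nat" where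
  "max_resonance_length \<beta> = Max {mi_length p | p. \<exists>j. \<beta> $ j = mono_pow \<beta> p}"

definition resonances :: "'n::{finite,linorder} cvec \<Rightarrow> 'n \<Rightarrow> 'n multi_index set" where
  "resonances \<beta> j = {p. \<beta> $ j = mono_pow \<beta> p \<and> (\<forall>k\<ge>j. p \<noteq> axis k 1)}"

definition sub_resonances :: "'n::{finite,linorder} cvec \<Rightarrow> 'n \<Rightarrow> 'n multi_index set" where
  "sub_resonances \<beta> j = {q. q \<noteq> 0 \<and> (\<exists>p\<in>resonances \<beta> j. \<forall>l. q $ l \<le> p $ l)}"

text \<open>
  The superscript \<open>r\<close> of the group is read as a bound on the degree. For \<open>r\<close> the maximal length
  of the resonances the bound holds automatically, and the exponents for the \<open>j\<close>-th component
  involve only the variables of index less than \<open>j\<close>; both are proved below when all moduli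
  lie in \<open>(0,1)\<close>, as they do for the eigenvalues of a contraction.
\<close>

definition subresonant_group ::
    "nat \<Rightarrow> 'n::{finite,linorder} cvec \<Rightarrow> ('n cvec \<Rightarrow> 'n cvec) set" where
  "subresonant_group r \<beta> =
     {P. \<exists>(a :: 'n \<Rightarrow> complex) (c :: 'n \<Rightarrow> 'n multi_index \<Rightarrow> complex). (\<forall>j. a j \<noteq> 0) \<and>
        (\<forall>z j. P z $ j = a j * z $ j +
           (\<Sum>q | q \<in> sub_resonances \<beta> j \<and> mi_length q \<le> r. c j q * mono_pow z q))}"

context
  fixes \<beta> :: "'n::{finite,linorder} cvec"
  assumes \<beta>_pos: "\<And>j. 0 < cmod (\<beta> $ j)" and \<beta>_less: "\<And>j. cmod (\<beta> $ j) < 1"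
begin

lemma finite_resonance_lengths:
  "finite {mi_length p | p. \<exists>j. \<beta> $ j = mono_pow \<beta> p}"
proof -
  define M where "M = Max (range (\<lambda>j. cmod (\<beta> $ j)))"
  define m where "m = Min (range (\<lambda>j. cmod (\<beta> $ j)))"
  have M: "cmod (\<beta> $ j) \<le> M" and m: "m \<le> cmod (\<beta> $ j)" for j
    by (auto simp: M_def m_def)
  have "M \<in> range (\<lambda>j. cmod (\<beta> $ j))" "m \<in> range (\<lambda>j. cmod (\<beta> $ j))"
    unfolding M_def m_def by (intro Max_in Min_in; simp)+
  then have "M < 1" "0 < m" "0 \<le> M" using \<beta>_pos \<beta>_less by auto
  have "(\<lambda>N. M ^ N) \<longlonglongrightarrow> 0" using \<open>M < 1\<close> \<open>0 \<le> M\<close> by (simp add: LIMSEQ_realpow_zero)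
  then have "\<forall>\<^sub>F k in sequentially. M ^ k < m" using \<open>0 < m\<close> by (rule order_tendstoD(2))
  then obtain N where N: "\<And>k. k \<ge> N \<Longrightarrow> M ^ k < m"
    unfolding eventually_sequentially by blast
  have "mi_length p < N" if "\<beta> $ j = mono_pow \<beta> p" for j p
  proof (rule ccontr)
    assume "\<not> mi_length p < N"
    then have "M ^ mi_length p < m" by (intro N) simp
    moreover have "cmod (mono_pow \<beta> p) \<le> (\<Prod>l\<in>UNIV. M ^ (p $ l))"
      unfolding mono_pow_def prod_norm[symmetric] norm_power
      by (intro prod_mono conjI power_mono M) auto
    moreover have "(\<Prod>l\<in>UNIV. M ^ (p $ l)) = M ^ mi_length p"
      by (simp add: mi_length_def power_sum)
    ultimately show False using m[of j] that by simp
  qed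
  then have "{mi_length p | p. \<exists>j. \<beta> $ j = mono_pow \<beta> p} \<subseteq> {..<N}" by auto
  then show ?thesis using finite_subset by blast
qed

lemma sub_resonance_length_le:
  assumes "q \<in> sub_resonances \<beta> j"
  shows "mi_length q \<le> max_resonance_length \<beta>"
proof -
  obtain p where p: "\<beta> $ j = mono_pow \<beta> p" "\<And>l. q $ l \<le> p $ l"
    using assms by (auto simp: sub_resonances_def resonances_def)
  have "mi_length q \<le> mi_length p" unfolding mi_length_def by (intro sum_mono p)
  also have "\<dots> \<le> max_resonance_length \<beta>"
    unfolding max_resonance_length_def using p(1) by (intro Max_ge finite_resonance_lengths) auto
  finally show ?thesis .
qed

lemma subresonant_group_max_resonance_length:
  "subresonant_group (max_resonance_length \<beta>) \<beta> =
     {P. \<exists>a c. (\<forall>j. a j \<noteq> 0) \<and>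
        (\<forall>z j. P z $ j = a j * z $ j + (\<Sum>q\<in>sub_resonances \<beta> j. c j q * mono_pow z q))}"
proof -
  have "{q. q \<in> sub_resonances \<beta> j \<and> mi_length q \<le> max_resonance_length \<beta>} = sub_resonances \<beta> j"
    for j using sub_resonance_length_le by auto
  then show ?thesis by (simp add: subresonant_group_def)
qed

lemma sub_resonance_triangular:
  assumes ord: "\<And>i j. i \<le> j \<Longrightarrow> cmod (\<beta> $ j) \<le> cmod (\<beta> $ i)"
    and q: "q \<in> sub_resonances \<beta> j" and l: "j \<le> l"
  shows "q $ l = 0"
proof (rule ccontr)
  assume "q $ l \<noteq> 0"
  moreover obtain p where p: "\<beta> $ j = mono_pow \<beta> p" "\<And>k. k \<ge> j \<Longrightarrow> p \<noteq> axis k 1" "q $ l \<le> p $ l"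
    using q by (auto simp: sub_resonances_def resonances_def)
  ultimately obtain s where s: "p $ l = Suc s" by (cases "p $ l") auto
  define R where "R = (\<Prod>k\<in>UNIV - {l}. cmod (\<beta> $ k) ^ (p $ k))"
  have le1: "cmod (\<beta> $ k) ^ i \<le> 1" for k i
    using \<beta>_less[of k] by (simp add: power_le_one)
  have R1: "R \<le> 1" and R0: "0 \<le> R"
    unfolding R_def by (auto intro!: prod_le_1 prod_nonneg le1)
  have eq: "cmod (\<beta> $ j) = cmod (\<beta> $ l) * (cmod (\<beta> $ l) ^ s * R)"
    unfolding p(1) mono_pow_def prod_norm[symmetric] norm_power R_def
    by (subst prod.remove[of _ l]) (auto simp: s)
  have "cmod (\<beta> $ l) * 1 \<le> cmod (\<beta> $ l) * (cmod (\<beta> $ l) ^ s * R)"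
    using ord[OF l] eq by simp
  then have ge: "1 \<le> cmod (\<beta> $ l) ^ s * R"
    using \<beta>_pos[of l] mult_le_cancel_left_pos by blast
  have "cmod (\<beta> $ l) ^ s * R \<le> cmod (\<beta> $ l) ^ s * 1" by (intro mult_left_mono R1) auto
  then have s1: "1 \<le> cmod (\<beta> $ l) ^ s" using ge by linarith
  have s0: "s = 0"
  proof (rule ccontr)
    assume "s \<noteq> 0"
    then have "cmod (\<beta> $ l) ^ s < 1" using \<beta>_less[of l] by (simp add: power_Suc_less_one power_less_one_iff)
    with s1 show False by simp
  qed
  have p0: "p $ k = 0" if "k \<noteq> l" for k
  proof (rule ccontr)
    assume "p $ k \<noteq> 0"
    then have lt: "cmod (\<beta> $ k) ^ (p $ k) < 1"
      using \<beta>_less[of k] by (simp add: power_less_one_iff)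
    have "R = cmod (\<beta> $ k) ^ (p $ k) * (\<Prod>i\<in>UNIV - {l} - {k}. cmod (\<beta> $ i) ^ (p $ i))"
      unfolding R_def using that by (subst prod.remove[of _ k]) auto
    also have "\<dots> \<le> cmod (\<beta> $ k) ^ (p $ k) * 1"
      by (intro mult_left_mono prod_le_1) (auto intro: le1)
    finally show False using lt ge s0 by simp
  qed
  have "p = axis l 1" using p0 s s0 by (auto simp: vec_eq_iff axis_def)
  with p(2) l show False by blast
qed

end

end

theory Submission
  imports Defs "HOL-Complex_Analysis.Cauchy_Integral_Formula"
begin

text \<open>
  The proof linearises the problem by passing from \<open>\<gamma>\<close> to the composition operator
  \<open>C f = f \<circ> \<gamma>\<close> on entire functions \<open>f : \<complex>\<^sup>n \<rightarrow> \<complex>\<close>. A conjugacy \<open>\<Psi> = \<phi>\<inverse>\<close> from \<open>\<gamma>\<close> to a normal form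
  is a system of coordinates \<open>\<Psi>\<^sub>1, \<dots>, \<Psi>\<^sub>n\<close> with
  \<open>C \<Psi>\<^sub>j = \<beta>\<^sub>j \<Psi>\<^sub>j + (combination of resonant monomials \<Psi>\<^sup>p, \<beta>\<^sup>p = \<beta>\<^sub>j)\<close>, so that only linear equations of
  the form \<open>(C - \<mu>) h = g\<close> have to be solved, and they are solved on all of \<open>\<complex>\<^sup>n\<close> at once.

  After a linear change of coordinates (\<open>triangularize\<close>) the differential of \<open>\<gamma>\<close> at \<open>0\<close> is lower
  triangular with diagonal \<open>\<beta>\<close>. Give the coordinate \<open>z\<^sub>l\<close> a weight that decreases with \<open>l\<close> and lies
  between \<open>n\<close> and \<open>2n - 1\<close>. Then the off-diagonal linear terms of \<open>\<gamma>\<^sub>l\<close> are heavier than \<open>z\<^sub>l\<close>, and so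
  are all its nonlinear terms, whose weight is at least \<open>2n\<close>. On the filtration of the entire functions
  by the weight of their leading term, \<open>C\<close> therefore acts diagonally: it maps \<open>z\<^sup>p\<close> to \<open>\<beta>\<^sup>p z\<^sup>p\<close> up to
  heavier terms. Hence the leading monomials of a given \<open>g\<close> can be removed weight by weight, the
  nonresonant ones by subtracting \<open>(C - \<mu>)\<close> of a multiple of \<open>z\<^sup>p\<close>, the resonant ones by subtracting a
  multiple of \<open>\<Psi>\<^sup>p\<close> (\<open>eliminate_weights\<close>). Once \<open>g\<close> vanishes to high order the contraction
  \<open>\<gamma>\<^sup>i(z) \<rightarrow> 0\<close> beats the factors \<open>\<mu>\<^sup>-\<^sup>i\<close>, and the series \<open>h = - \<Sum> \<mu>\<^sup>-\<^sup>i\<^sup>-\<^sup>1 g \<circ> \<gamma>\<^sup>i\<close> converges locally uniformly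
  on \<open>\<complex>\<^sup>n\<close> (\<open>solve_cohomological\<close>). A resonant monomial heavier than \<open>z\<^sub>j\<close> involves only the variables
  before \<open>j\<close>, so the \<open>\<Psi>\<^sub>j\<close> can be constructed one after the other (\<open>semiconjugacy\<close>).

  The resulting \<open>\<Psi>\<close> satisfies \<open>\<Psi> \<circ> \<gamma> = P \<circ> \<Psi>\<close> with \<open>P\<close> in the subresonant group, and is a local
  biholomorphism at \<open>0\<close>. Both \<open>\<gamma>\<close> and the triangular map \<open>P\<close> are injective and contract to \<open>0\<close>, so every
  global statement about \<open>\<Psi>\<close> is transported by iteration to a statement near \<open>0\<close>, and \<open>\<Psi>\<close> is a
  biholomorphism of \<open>\<complex>\<^sup>n\<close> (\<open>conjugate_to_subresonant\<close>).

  The analysis behind this is elementary. Everything about functions of several variables is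
  obtained by restricting them to complex lines and weighted curves and applying Cauchy's estimates
  there: closure under locally uniform limits (\<open>entire_approx\<close>) and the weighted Taylor expansion
  (\<open>weighted_taylor\<close>).
\<close>

section \<open>Entire functions of several variables\<close>

lemma has_derivative_vecI:
  fixes f :: "'a::real_normed_vector \<Rightarrow> complex^'m"
  assumes "\<And>i. ((\<lambda>x. f x $ i) has_derivative (\<lambda>h. f' h $ i)) (at x within S)"
  shows "(f has_derivative f') (at x within S)"
  unfolding has_derivative_componentwise_within[of f]
proof
  fix b :: "complex^'m" assume "b \<in> Basis"
  then obtain i u where b: "b = axis i u" by (auto simp: Basis_vec_def)
  show "((\<lambda>x. f x \<bullet> b) has_derivative (\<lambda>x. f' x \<bullet> b)) (at x within S)"
    unfolding b inner_axis by (intro has_derivative_inner_left assms)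
qed

lemma norm_vector_smult: "norm (c *s v) = cmod c * norm (v :: complex^'n)"
  by (simp add: norm_vec_def norm_mult L2_set_right_distrib)

lemma norm_vec_nth_le: "cmod (z $ l) \<le> norm (z :: complex^'n)"
  by (rule Finite_Cartesian_Product.norm_nth_le)

lemma continuous_smult [continuous_intros]:
  fixes g :: "'a::topological_space \<Rightarrow> complex^'n"
  assumes "continuous_on S f" "continuous_on S g"
  shows "continuous_on S (\<lambda>x. f x *s g x)"
  unfolding vector_scalar_mult_def by (intro continuous_intros assms)

text \<open>
  The scalar counterpart of \<^const>\<open>holomorphic_map\<close>. A Frechet derivative is real linear anyway, so
  homogeneity over \<open>\<complex>\<close> is all that has to be added to make it complex linear.
\<close>

definition entire :: "(complex^'n \<Rightarrow> complex) \<Rightarrow> bool" where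
  "entire f \<longleftrightarrow> (\<forall>z. \<exists>f'. (\<forall>c v. f' (c *s v) = c * f' v) \<and> (f has_derivative f') (at z))"

abbreviation differential :: "(complex^'n \<Rightarrow> complex) \<Rightarrow> complex^'n \<Rightarrow> complex^'n \<Rightarrow> complex" where
  "differential f z \<equiv> frechet_derivative f (at z)"

lemma entire_differential:
  assumes "entire f"
  shows "(f has_derivative differential f z) (at z)"
    and "differential f z (c *s v) = c * differential f z v"
proof -
  obtain f' where f': "\<And>c v. f' (c *s v) = c * f' v" "(f has_derivative f') (at z)"
    using assms unfolding entire_def by blast
  then have "differential f z = f'" using frechet_derivative_at[OF f'(2)] by simp
  with f' show "(f has_derivative differential f z) (at z)"
    "differential f z (c *s v) = c * differential f z v" by simp_all
qed

lemma entireI: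
  assumes "\<And>z. (f has_derivative f' z) (at z)" "\<And>z c v. f' z (c *s v) = c * f' z v"
  shows "entire f"
  using assms unfolding entire_def by blast

lemma entire_const [intro]: "entire (\<lambda>z. c)"
  by (rule entireI[of _ "\<lambda>z v. 0"]) auto

lemma entire_coord [intro]: "entire (\<lambda>z. z $ l)"
  by (rule entireI[of _ "\<lambda>z v. v $ l"])
     (auto intro: bounded_linear_imp_has_derivative bounded_linear_vec_nth)

lemma entire_add [intro]: "entire f \<Longrightarrow> entire g \<Longrightarrow> entire (\<lambda>z. f z + g z)"
  by (rule entireI[of _ "\<lambda>z v. differential f z v + differential g z v"])
     (auto intro: has_derivative_add entire_differential simp: entire_differential algebra_simps)

lemma entire_mult [intro]: "entire f \<Longrightarrow> entire g \<Longrightarrow> entire (\<lambda>z. f z * g z)"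
  by (rule entireI[of _ "\<lambda>z v. f z * differential g z v + differential f z v * g z"])
     (intro has_derivative_mult entire_differential, assumption+, simp only: entire_differential, simp add: algebra_simps)

lemma entire_diff [intro]: "entire f \<Longrightarrow> entire g \<Longrightarrow> entire (\<lambda>z. f z - g z)"
  using entire_add[OF _ entire_mult[OF entire_const[of "-1"]], of f g] by simp

lemma entire_divide_const [intro]: "entire f \<Longrightarrow> entire (\<lambda>z. f z / c)"
  using entire_mult[OF _ entire_const[of "inverse c"], of f] by (simp add: field_simps)

lemma entire_power [intro]: "entire f \<Longrightarrow> entire (\<lambda>z. f z ^ k)"
  by (induction k) auto

lemma entire_sum [intro]: "(\<And>i. i \<in> I \<Longrightarrow> entire (f i)) \<Longrightarrow> entire (\<lambda>z. \<Sum>i\<in>I. f i z)"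
  by (induction I rule: infinite_finite_induct) auto

lemma entire_prod [intro]: "(\<And>i. i \<in> I \<Longrightarrow> entire (f i)) \<Longrightarrow> entire (\<lambda>z. \<Prod>i\<in>I. f i z)"
  by (induction I rule: infinite_finite_induct) auto

lemma entire_continuous_on [continuous_intros]: "entire f \<Longrightarrow> continuous_on S f"
  by (meson continuous_at_imp_continuous_on entire_differential(1) has_derivative_continuous)

lemma entire_compose:
  assumes f: "entire f" and g: "\<And>l. entire (\<lambda>z. g z $ l)"
  shows "entire (\<lambda>z. f (g z))"
proof (rule entireI)
  fix z
  have "(g has_derivative (\<lambda>v. \<chi> l. differential (\<lambda>z. g z $ l) z v)) (at z)"
    by (rule has_derivative_vecI) (simp add: entire_differential[OF g])
  from has_derivative_compose[OF this entire_differential(1)[OF f]]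
  show "((\<lambda>z. f (g z)) has_derivative
      (\<lambda>v. differential f (g z) (\<chi> l. differential (\<lambda>z. g z $ l) z v))) (at z)" .
next
  fix z c v
  have "(\<chi> l. differential (\<lambda>z. g z $ l) z (c *s v)) = c *s (\<chi> l. differential (\<lambda>z. g z $ l) z v)"
    by (simp add: vec_eq_iff entire_differential[OF g])
  then show "differential f (g z) (\<chi> l. differential (\<lambda>z. g z $ l) z (c *s v)) =
      c * differential f (g z) (\<chi> l. differential (\<lambda>z. g z $ l) z v)"
    by (simp add: entire_differential[OF f])
qed

lemma entire_along_curve:
  assumes f: "entire f" and c: "\<And>l. ((\<lambda>t. c t $ l) has_field_derivative c' $ l) (at t)"
  shows "((\<lambda>t. f (c t)) has_field_derivative differential f (c t) c') (at t)"
proof -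
  have "(c has_derivative (\<lambda>h. h *s c')) (at t)"
    using c by (intro has_derivative_vecI)
      (simp add: has_field_derivative_def mult.commute[of _ "c' $ _"])
  from has_derivative_compose[OF this entire_differential(1)[OF f]]
  show ?thesis by (simp add: has_field_derivative_def entire_differential(2)[OF f] mult.commute[of _ "differential _ _ _"])
qed

lemma entire_along_line:
  "entire f \<Longrightarrow> ((\<lambda>t. f (a + t *s v)) has_field_derivative differential f (a + t *s v) v) (at t)"
  by (rule entire_along_curve) (auto intro!: derivative_eq_intros)

text \<open>
  Cauchy's inequality for the restriction of \<open>f\<close> to the disc \<open>t \<mapsto> z + t v\<close>, \<open>|t| \<le> 1\<close>.
\<close>

lemma differential_bound:
  assumes f: "entire f" and B: "\<And>w. norm (w - z) \<le> norm v \<Longrightarrow> cmod (f w) \<le> B"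
  shows "cmod (differential f z v) \<le> B"
proof -
  let ?g = "\<lambda>t. f (z + t *s v)"
  have d: "(?g has_field_derivative differential f (z + t *s v) v) (at t)" for t
    using entire_along_line[OF f] .
  have hol: "?g holomorphic_on UNIV" using d by (auto simp: holomorphic_on_open)
  have "norm ((deriv ^^ 1) ?g 0) \<le> fact 1 * B / 1 ^ 1"
  proof (rule Cauchy_inequality)
    show "?g holomorphic_on ball 0 1" using hol holomorphic_on_subset by blast
    show "continuous_on (cball 0 1) ?g"
      using hol holomorphic_on_imp_continuous_on holomorphic_on_subset by blast
    show "cmod (f (z + t *s v)) \<le> B" if "cmod (0 - t) = 1" for t
      using that by (intro B) (simp add: norm_vector_smult)
  qed simp
  moreover have "deriv ?g 0 = differential f z v"
    using DERIV_imp_deriv[OF d[of 0]] by simp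
  ultimately show ?thesis by simp
qed

lemma differential_diff:
  assumes "entire f" "entire g"
  shows "differential (\<lambda>z. f z - g z) z v = differential f z v - differential g z v"
proof -
  have "((\<lambda>z. f z - g z) has_derivative (\<lambda>v. differential f z v - differential g z v)) (at z)"
    by (intro has_derivative_diff entire_differential assms)
  from frechet_derivative_at[OF this] show ?thesis by metis
qed

lemma differential_bound_diff:
  assumes f: "entire f" and g: "entire g"
    and B: "\<And>w. norm (w - z) \<le> 1 \<Longrightarrow> cmod (f w - g w) \<le> B"
  shows "cmod (differential f z v - differential g z v) \<le> B * norm v"
proof (cases "v = 0")
  case True
  have "differential f z 0 = 0" if "entire f" for f
    using entire_differential(2)[OF that, of z 0 0] by simp
  then show ?thesis using True f g by simp
next
  case False
  define u where "u = complex_of_real (inverse (norm v)) *s v"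
  have v: "v = complex_of_real (norm v) *s u" and u: "norm u = 1"
    using False by (auto simp: u_def norm_vector_smult norm_inverse vec_eq_iff)
  have "cmod (differential (\<lambda>z. f z - g z) z u) \<le> B"
    using f g B u by (intro differential_bound) auto
  then have "cmod (differential f z u - differential g z u) \<le> B"
    using f g by (simp add: differential_diff)
  moreover have "differential f z v - differential g z v
    = norm v * (differential f z u - differential g z u)"
    by (subst (1 2) v) (simp add: entire_differential[OF f] entire_differential[OF g] algebra_simps)
  ultimately show ?thesis
    by (simp add: norm_mult mult_left_mono mult.commute[of B])
qed

text \<open>
  By Cauchy's inequality, functions that are uniformly close on a ball have uniformly close
  differentials on a smaller one, so differentials pass to the limit. Phrased as approximability on
  every ball, the result applies to sequences and to limits over a continuous parameter alike.
\<close>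

lemma entire_approx:
  fixes f :: "complex^'n \<Rightarrow> complex"
  assumes ap: "\<And>R e. e > 0 \<Longrightarrow> \<exists>g. entire g \<and> (\<forall>z\<in>cball 0 R. cmod (g z - f z) \<le> e)"
  shows "entire f"
proof -
  have "\<exists>f'. (\<forall>c v. f' (c *s v) = c * f' v) \<and> (f has_derivative f') (at a)" for a
  proof -
    have "\<forall>n. \<exists>g. entire g \<and> (\<forall>z\<in>cball 0 (norm a + 2). cmod (g z - f z) \<le> inverse (Suc n))"
      using ap by simp
    from choice[OF this] obtain g where "\<forall>n. entire (g n) \<and>
      (\<forall>z\<in>cball 0 (norm a + 2). cmod (g n z - f z) \<le> inverse (Suc n))" ..
    then have g: "\<And>n. entire (g n)"
      and gf: "\<And>n z. norm z \<le> norm a + 2 \<Longrightarrow> cmod (g n z - f z) \<le> inverse (Suc n)"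
      by simp_all
    let ?S = "ball a 1"
    have close: "cmod (differential (g m) z v - differential (g n) z v)
        \<le> (inverse (Suc m) + inverse (Suc n)) * norm v" if "z \<in> ?S" for m n z v
    proof (rule differential_bound_diff[OF g g])
      fix w assume w: "norm (w - z) \<le> 1"
      have "norm w \<le> norm (w - z) + norm (z - a) + norm a"
        using norm_triangle_ineq[of "w - z" "z - a"] norm_triangle_ineq[of "w - a" a] by simp
      also have "\<dots> \<le> norm a + 2" using w that by (simp add: dist_norm norm_minus_commute)
      finally have "norm w \<le> norm a + 2" .
      from gf[OF this, of m] gf[OF this, of n] norm_triangle_ineq4[of "g m w - f w" "g n w - f w"]
      show "cmod (g m w - g n w) \<le> inverse (Suc m) + inverse (Suc n)" by simp
    qed
    define D where "D z v = lim (\<lambda>n. differential (g n) z v)" for z v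
    have lim: "(\<lambda>n. differential (g n) z v) \<longlonglongrightarrow> D z v" if z: "z \<in> ?S" for z v
    proof -
      have "Cauchy (\<lambda>n. differential (g n) z v)"
      proof (rule metric_CauchyI)
        fix e :: real assume "e > 0"
        then obtain M where M: "inverse (Suc M) < e / (2 * (norm v + 1))"
          using reals_Archimedean[of "e / (2 * (norm v + 1))"]
          by (auto simp: add_pos_nonneg add_nonneg_pos)
        have "dist (differential (g m) z v) (differential (g n) z v) < e"
          if mn: "m \<ge> M" "n \<ge> M" for m n
        proof -
          have "inverse (Suc m) \<le> inverse (Suc M)" "inverse (Suc n) \<le> inverse (Suc M)"
            using mn by (auto intro!: le_imp_inverse_le simp del: of_nat_Suc)
          then have "inverse (Suc m) + inverse (Suc n) \<le> 2 * inverse (real (Suc M))" by linarith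
          with close[OF z, of m v n]
          have "cmod (differential (g m) z v - differential (g n) z v) \<le> 2 * inverse (Suc M) * norm v"
            by (meson mult_right_mono norm_ge_zero order_trans)
          also have "\<dots> \<le> 2 * inverse (Suc M) * (norm v + 1)" by (intro mult_left_mono) auto
          also have "\<dots> < e" using M by (simp add: field_simps add_pos_nonneg add_nonneg_pos)
          finally show ?thesis by (simp add: dist_norm)
        qed
        then show "\<exists>M. \<forall>m\<ge>M. \<forall>n\<ge>M. dist (differential (g m) z v) (differential (g n) z v) < e" by blast
      qed
      then show ?thesis unfolding D_def by (simp add: Cauchy_convergent_iff convergent_LIMSEQ_iff)
    qed
    have inv0: "(\<lambda>n. inverse (real (Suc n))) \<longlonglongrightarrow> 0" by (rule LIMSEQ_inverse_real_of_nat)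
    have uni: "cmod (differential (g n) z v - D z v) \<le> inverse (Suc n) * norm v" if z: "z \<in> ?S" for n z v
    proof (rule LIMSEQ_le)
      show "(\<lambda>m. cmod (differential (g n) z v - differential (g m) z v)) \<longlonglongrightarrow> cmod (differential (g n) z v - D z v)"
        by (intro tendsto_intros lim z)
      have "(\<lambda>m. (inverse (Suc n) + inverse (Suc m)) * norm v) \<longlonglongrightarrow> (inverse (Suc n) + 0) * norm v"
        by (intro tendsto_intros inv0)
      then show "(\<lambda>m. (inverse (Suc n) + inverse (Suc m)) * norm v) \<longlonglongrightarrow> inverse (Suc n) * norm v" by simp
    qed (use close[OF z, of n v] in auto)
    have gl: "(\<lambda>n. g n z) \<longlonglongrightarrow> f z" if "z \<in> ?S" for z
    proof -
      have "norm z \<le> norm a + 2" using that norm_triangle_ineq2[of z a]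
        by (simp add: dist_norm norm_minus_commute)
      then have "norm (g n z - f z) \<le> inverse (real (Suc n))" for n using gf by blast
      then have "(\<lambda>n. g n z - f z) \<longlonglongrightarrow> 0"
        by (intro Lim_null_comparison[OF _ inv0]) auto
      then show ?thesis by (simp add: LIM_zero_iff)
    qed
    have "\<exists>h. \<forall>z\<in>?S. (\<lambda>n. g n z) \<longlonglongrightarrow> h z \<and> (h has_derivative D z) (at z within ?S)"
    proof (rule has_derivative_sequence[where f' = "\<lambda>n. differential (g n)"])
      show "(g n has_derivative differential (g n) x) (at x within ?S)" for n x
        by (rule has_derivative_at_withinI) (rule entire_differential[OF g])
      fix e :: real assume "e > 0"
      then obtain M where M: "inverse (Suc M) < e" using reals_Archimedean by blast
      show "\<forall>\<^sub>F n in sequentially. \<forall>x\<in>?S. \<forall>h. cmod (differential (g n) x h - D x h) \<le> e * norm h"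
      proof (intro eventually_sequentiallyI[of M] ballI allI)
        fix n x h assume "M \<le> n" "x \<in> ?S"
        then have "inverse (Suc n) \<le> inverse (Suc M)" by (auto intro!: le_imp_inverse_le simp del: of_nat_Suc)
        then have "inverse (Suc n) \<le> e" using M by linarith
        then show "cmod (differential (g n) x h - D x h) \<le> e * norm h"
          using uni[OF \<open>x \<in> ?S\<close>, of n h] by (meson mult_right_mono norm_ge_zero order_trans)
      qed
    qed (use gl[of a] in auto)
    then obtain h where h: "\<And>z. z \<in> ?S \<Longrightarrow> (\<lambda>n. g n z) \<longlonglongrightarrow> h z" "\<And>z. z \<in> ?S \<Longrightarrow> (h has_derivative D z) (at z within ?S)"
      by blast
    have hf: "h z = f z" if "z \<in> ?S" for z using LIMSEQ_unique[OF h(1) gl] that by blast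
    have "(h has_derivative D a) (at a)"
      using h(2)[of a] by (simp add: at_within_open[of a ?S])
    then have "(f has_derivative D a) (at a)"
      by (rule has_derivative_transform_within_open[of _ _ _ _ ?S]) (auto simp: hf)
    moreover have "D a (c *s v) = c * D a v" for c v
    proof (rule LIMSEQ_unique[OF lim])
      show "(\<lambda>n. differential (g n) a (c *s v)) \<longlonglongrightarrow> c * D a v"
        by (simp add: entire_differential[OF g] tendsto_mult_left lim)
    qed simp
    ultimately show ?thesis by blast
  qed
  then show ?thesis unfolding entire_def by blast
qed

section \<open>Taylor coefficients along families of discs\<close>

definition taylor_coeff :: "nat \<Rightarrow> (complex \<Rightarrow> complex) \<Rightarrow> complex" where
  "taylor_coeff k g = (deriv ^^ k) g 0 / fact k"

text \<open>
  Radius \<open>1\<close> suffices in these estimates because they are applied only to entire functions of one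
  variable, which can be rescaled.
\<close>

context
  fixes g :: "complex \<Rightarrow> complex" and B :: real
  assumes hol: "g holomorphic_on UNIV" and B: "\<And>t. cmod t \<le> 1 \<Longrightarrow> cmod (g t) \<le> B"
begin

lemma taylor_coeff_bound: "cmod (taylor_coeff k g) \<le> B"
proof -
  have "cmod ((deriv ^^ k) g 0) \<le> fact k * B / 1 ^ k"
  proof (rule Cauchy_inequality)
    show "g holomorphic_on ball 0 1" using hol holomorphic_on_subset by blast
    show "continuous_on (cball 0 1) g"
      using hol holomorphic_on_imp_continuous_on holomorphic_on_subset by blast
  qed (auto intro: B)
  then show ?thesis by (simp add: taylor_coeff_def norm_divide field_simps)
qed

lemma taylor_remainder:
  assumes t: "cmod t \<le> 1/2"
  shows "cmod (g t - (\<Sum>j<k. taylor_coeff j g * t ^ j)) \<le> 2 * B * cmod t ^ k"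
proof -
  have B0: "0 \<le> B" using order_trans[OF norm_ge_zero B[of 0]] by simp
  have "g holomorphic_on ball 0 1" using hol holomorphic_on_subset by blast
  then have "(\<lambda>n. taylor_coeff n g * t ^ n) sums g t"
    using holomorphic_power_series[of g 0 1 t] t by (simp add: taylor_coeff_def)
  from sums_split_initial_segment[OF this, of k]
  have 1: "(\<lambda>n. taylor_coeff (n + k) g * t ^ (n + k)) sums (g t - (\<Sum>j<k. taylor_coeff j g * t ^ j))" .
  have "(\<lambda>n. (B * cmod t ^ k) * cmod t ^ n) sums ((B * cmod t ^ k) * (1 / (1 - cmod t)))"
    using t by (intro sums_mult geometric_sums) auto
  then have 2: "(\<lambda>n. B * cmod t ^ (n + k)) sums (B * cmod t ^ k * (1 / (1 - cmod t)))"
    by (simp add: power_add mult_ac)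
  have "cmod (g t - (\<Sum>j<k. taylor_coeff j g * t ^ j)) \<le> B * cmod t ^ k * (1 / (1 - cmod t))"
    by (rule norm_sums_le[OF 1 2])
       (simp add: norm_mult norm_power mult_right_mono taylor_coeff_bound)
  also have "\<dots> \<le> B * cmod t ^ k * 2"
    using t B0 by (intro mult_left_mono) (auto simp: field_simps)
  finally show ?thesis by (simp add: mult_ac)
qed

text \<open>
  If the coefficients below \<open>j\<close> are zero then \<open>g(t)\<close> is the \<open>j\<close>-th term up to \<open>O(t\<^sup>j\<^sup>+\<^sup>1)\<close>, which for
  \<open>j < s\<close> is compatible with the growth of \<open>g\<close> only if that term is zero as well.
\<close>

lemma taylor_coeff_eq_0:
  assumes C: "\<forall>\<^sub>F t in at_right 0. cmod (g (of_real t)) \<le> C * t ^ s" and j: "j < s"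
  shows "taylor_coeff j g = 0"
  using j
proof (induction j rule: less_induct)
  case (less j)
  have B0: "0 \<le> B" using order_trans[OF norm_ge_zero B[of 0]] by simp
  let ?a = "cmod (taylor_coeff j g)"
  have half: "\<forall>\<^sub>F t in at_right (0::real). t < 1/2" by (intro eventually_at_rightI[of 0 "1/2"]) auto
  have "\<forall>\<^sub>F t in at_right 0. ?a \<le> (\<bar>C\<bar> + 2 * B) * t"
    using C half eventually_at_right_less[of 0]
  proof eventually_elim
    case (elim t)
    have "(\<Sum>i<Suc j. taylor_coeff i g * of_real t ^ i) = taylor_coeff j g * of_real t ^ j"
      using less by simp
    then have "cmod (g (of_real t) - taylor_coeff j g * of_real t ^ j) \<le> 2 * B * t ^ Suc j"
      using taylor_remainder[of "of_real t" "Suc j"] elim by simp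
    then have "cmod (taylor_coeff j g * of_real t ^ j) \<le> C * t ^ s + 2 * B * t ^ Suc j"
      using elim(1) norm_triangle_ineq2[of "taylor_coeff j g * of_real t ^ j" "g (of_real t)"]
      by (simp add: norm_minus_commute)
    also have "C * t ^ s \<le> \<bar>C\<bar> * t ^ Suc j"
      using elim less.prems by (intro mult_mono power_decreasing) auto
    finally have "?a * t ^ j \<le> ((\<bar>C\<bar> + 2 * B) * t) * t ^ j"
      using elim by (simp add: norm_mult norm_power algebra_simps)
    then show ?case using elim by simp
  qed
  moreover have "((\<lambda>t. (\<bar>C\<bar> + 2 * B) * t) \<longlongrightarrow> (\<bar>C\<bar> + 2 * B) * 0) (at_right 0)"
    by (intro tendsto_intros)
  ultimately have "?a \<le> (\<bar>C\<bar> + 2 * B) * 0"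
    by (intro tendsto_le[OF _ _ tendsto_const]) auto
  then show ?case by simp
qed

end

text \<open>
  The \<open>k\<close>-th coefficient is the limit, as \<open>r \<rightarrow> 0\<close>, of the Taylor remainder of order \<open>k\<close> at \<open>t = r\<close>
  divided by \<open>r\<^sup>k\<close>, and the remainder estimate makes this limit locally uniform in \<open>z\<close>. By induction
  the remainders are entire in \<open>z\<close>.
\<close>

lemma entire_taylor_coeff:
  fixes g :: "complex \<Rightarrow> complex^'n \<Rightarrow> complex"
  assumes hol: "\<And>z. (\<lambda>t. g t z) holomorphic_on UNIV" and ent: "\<And>t. entire (g t)"
    and bd: "\<And>R. \<exists>B. \<forall>z\<in>cball 0 R. \<forall>t\<in>cball 0 1. cmod (g t z) \<le> B"
  shows "entire (\<lambda>z. taylor_coeff k (\<lambda>t. g t z))"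
proof (induction k rule: less_induct)
  case (less k)
  show ?case
  proof (rule entire_approx)
    fix R e :: real assume e: "0 < e"
    obtain B where B: "\<And>z t. z \<in> cball 0 R \<Longrightarrow> cmod t \<le> 1 \<Longrightarrow> cmod (g t z) \<le> B"
      using bd[of R] by (auto simp: Ball_def)
    \<comment> \<open>The remainder estimate needs \<open>r \<le> 1/2\<close> and yields the error \<open>2 B r\<close>.\<close>
    define r where "r = min (1/2) (e / (2 * \<bar>B\<bar> + 1))"
    have r: "0 < r" "r \<le> 1/2"
    proof -
      show "r \<le> 1/2" unfolding r_def by (rule min.cobounded1)
      have "0 < e / (2 * \<bar>B\<bar> + 1)" using e by (intro divide_pos_pos) auto
      then show "0 < r" unfolding r_def by simp
    qed
    have "r \<le> e / (2 * \<bar>B\<bar> + 1)" unfolding r_def by (rule min.cobounded2)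
    moreover have "0 < 2 * \<bar>B\<bar> + 1" by linarith
    ultimately have "r * (2 * \<bar>B\<bar> + 1) \<le> e" using pos_le_divide_eq by metis
    then have re: "2 * \<bar>B\<bar> * r \<le> e" using r by (simp add: distrib_left mult_ac)
    let ?h = "\<lambda>z. (g r z - (\<Sum>j<k. taylor_coeff j (\<lambda>t. g t z) * of_real r ^ j)) / of_real r ^ k"
    have "cmod (?h z - taylor_coeff k (\<lambda>t. g t z)) \<le> e" if z: "z \<in> cball 0 R" for z
    proof -
      have "?h z - taylor_coeff k (\<lambda>t. g t z)
          = (g r z - (\<Sum>j<Suc k. taylor_coeff j (\<lambda>t. g t z) * of_real r ^ j)) / of_real r ^ k"
        using r by (simp add: field_simps)
      also have "cmod \<dots> = cmod (g r z - (\<Sum>j<Suc k. taylor_coeff j (\<lambda>t. g t z) * of_real r ^ j)) / r ^ k"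
        using r by (simp only: norm_divide norm_power norm_of_real abs_of_pos)
      also have "\<dots> \<le> 2 * B * r ^ Suc k / r ^ k"
        using taylor_remainder[OF hol B[OF z], of r "Suc k"] r by (intro divide_right_mono) auto
      also have "\<dots> = 2 * B * r" using r by simp
      also have "\<dots> \<le> 2 * \<bar>B\<bar> * r" using r by (intro mult_right_mono) auto
      finally show ?thesis using re by linarith
    qed
    moreover have "entire ?h" using less ent by (intro entire_divide_const entire_diff entire_sum entire_mult) auto
    ultimately show "\<exists>h. entire h \<and> (\<forall>z\<in>cball 0 R. cmod (h z - taylor_coeff k (\<lambda>t. g t z)) \<le> e)"
      by blast
  qed
qed

lemma bounded_on_compact_family:
  fixes g :: "complex \<Rightarrow> complex^'n \<Rightarrow> complex"
  assumes "continuous_on UNIV (\<lambda>(t, z). g t z)"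
  shows "\<exists>B. \<forall>z\<in>cball 0 R. \<forall>t\<in>cball 0 1. cmod (g t z) \<le> B"
proof -
  have "compact ((\<lambda>(t, z). g t z) ` (cball 0 1 \<times> cball 0 R))"
    by (intro compact_continuous_image compact_Times continuous_on_subset[OF assms]) auto
  then obtain B where "\<And>x. x \<in> (\<lambda>(t, z). g t z) ` (cball 0 1 \<times> cball 0 R) \<Longrightarrow> cmod x \<le> B"
    using compact_imp_bounded bounded_iff by metis
  then show ?thesis by (intro exI[of _ B]) force
qed

lemma entire_partial:
  assumes f: "entire f"
  shows "entire (\<lambda>z. differential f z v)"
proof -
  have "entire (\<lambda>z. taylor_coeff 1 (\<lambda>t. f (z + t *s v)))"
  proof (rule entire_taylor_coeff)
    show "(\<lambda>t. f (z + t *s v)) holomorphic_on UNIV" for z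
      using entire_along_line[OF f] by (auto simp: holomorphic_on_open)
    show "entire (\<lambda>z. f (z + t *s v))" for t
      by (rule entire_compose[OF f]) auto
    show "\<exists>B. \<forall>z\<in>cball 0 R. \<forall>t\<in>cball 0 1. cmod (f (z + t *s v)) \<le> B" for R
      by (rule bounded_on_compact_family)
         (auto simp: case_prod_unfold intro!: continuous_on_compose2[OF entire_continuous_on[OF f, of UNIV]] continuous_intros)
  qed
  moreover have "taylor_coeff 1 (\<lambda>t. f (z + t *s v)) = differential f z v" for z
    using DERIV_imp_deriv[OF entire_along_line[OF f, of z v 0]] by (simp add: taylor_coeff_def)
  ultimately show ?thesis by simp
qed

lemma differential_sum_axis:
  fixes f :: "complex^'n \<Rightarrow> complex"
  assumes f: "entire f"
  shows "differential f z v = (\<Sum>l\<in>UNIV. v $ l * differential f z (axis l 1))"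
proof -
  have lin: "linear (differential f z)"
    using entire_differential(1)[OF f] has_derivative_linear by blast
  have "v = (\<Sum>l\<in>UNIV. (v $ l) *s axis l 1)" by (simp add: basis_expansion)
  then have "differential f z v = differential f z (\<Sum>l\<in>UNIV. (v $ l) *s axis l 1)" by simp
  also have "\<dots> = (\<Sum>l\<in>UNIV. v $ l * differential f z (axis l 1))"
    by (simp add: linear_sum[OF lin] entire_differential(2)[OF f])
  finally show ?thesis .
qed

section \<open>Weights and the weighted Taylor expansion\<close>

definition dilation :: "('n \<Rightarrow> nat) \<Rightarrow> complex \<Rightarrow> complex^'n \<Rightarrow> complex^'n" where
  "dilation w t z = (\<chi> l. t ^ w l * z $ l)"

definition weight :: "('n \<Rightarrow> nat) \<Rightarrow> nat^'n \<Rightarrow> nat" where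
  "weight w p = (\<Sum>l\<in>UNIV. w l * p $ l)"

text \<open>
  The box of size \<open>t\<close> is the image of the closed unit polydisc under the dilation by \<open>t\<close>. The boxes
  replace the balls of the quasi-norm \<open>max\<^sub>l |z\<^sub>l|\<^bsup>1/w l\<^esup>\<close>, whose roots they avoid.
\<close>

definition weighted_box :: "('n \<Rightarrow> nat) \<Rightarrow> real \<Rightarrow> (complex^'n) set" where
  "weighted_box w t = {z. \<forall>l. cmod (z $ l) \<le> t ^ w l}"

text \<open>
  For entire \<open>f\<close>: all monomials in the expansion at \<open>0\<close> have weight at least \<open>s\<close>. The definition by growth
  rather than by coefficients makes the compatibility with products and with composition immediate.
\<close>

definition vanishes :: "('n \<Rightarrow> nat) \<Rightarrow> nat \<Rightarrow> (complex^'n \<Rightarrow> complex) \<Rightarrow> bool" where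
  "vanishes w s f \<longleftrightarrow>
     (\<exists>C. \<forall>\<^sub>F t in at_right 0. \<forall>z\<in>weighted_box w t. cmod (f z) \<le> C * t ^ s)"

lemma dilation_nth [simp]: "dilation w t z $ l = t ^ w l * z $ l"
  by (simp add: dilation_def)

lemma dilation_dilation: "dilation w s (dilation w t z) = dilation w (s * t) z"
  by (simp add: vec_eq_iff power_mult_distrib)

lemma dilation_1 [simp]: "dilation w 1 z = z"
  by (simp add: vec_eq_iff)

lemma vanishesE:
  assumes "vanishes w s f"
  obtains C where "C \<ge> 0" "\<forall>\<^sub>F t in at_right 0. \<forall>z\<in>weighted_box w t. cmod (f z) \<le> C * t ^ s"
proof -
  obtain C where C: "\<forall>\<^sub>F t in at_right 0. \<forall>z\<in>weighted_box w t. cmod (f z) \<le> C * t ^ s"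
    using assms unfolding vanishes_def by blast
  have "\<forall>\<^sub>F t in at_right 0. \<forall>z\<in>weighted_box w t. cmod (f z) \<le> \<bar>C\<bar> * t ^ s"
    using C eventually_at_right_less[of 0]
    by eventually_elim (meson abs_ge_self less_imp_le mult_right_mono order_trans zero_le_power)
  then show ?thesis using that[of "\<bar>C\<bar>"] by simp
qed

lemma vanishes_zero [simp, intro]: "vanishes w s (\<lambda>z. 0)"
  unfolding vanishes_def by (intro exI[of _ 0]) simp

lemma vanishes_const: "vanishes w 0 (\<lambda>z. c)"
  unfolding vanishes_def by (intro exI[of _ "cmod c"]) simp

lemma vanishes_coord: "vanishes w (w l) (\<lambda>z. z $ l)"
  unfolding vanishes_def weighted_box_def by (intro exI[of _ 1]) simp

lemma vanishes_add:
  assumes "vanishes w s f" "vanishes w s g"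
  shows "vanishes w s (\<lambda>z. f z + g z)"
proof -
  obtain C where C: "\<forall>\<^sub>F t in at_right 0. \<forall>z\<in>weighted_box w t. cmod (f z) \<le> C * t ^ s"
    using assms(1) by (rule vanishesE)
  obtain D where D: "\<forall>\<^sub>F t in at_right 0. \<forall>z\<in>weighted_box w t. cmod (g z) \<le> D * t ^ s"
    using assms(2) by (rule vanishesE)
  have "\<forall>\<^sub>F t in at_right 0. \<forall>z\<in>weighted_box w t. cmod (f z + g z) \<le> (C + D) * t ^ s"
    using C D by eventually_elim (metis (no_types, opaque_lifting) add_mono distrib_right norm_triangle_le)
  then show ?thesis unfolding vanishes_def by blast
qed

lemma vanishes_mult:
  assumes "vanishes w s f" "vanishes w s' g"
  shows "vanishes w (s + s') (\<lambda>z. f z * g z)"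
proof -
  obtain C where C: "C \<ge> 0" "\<forall>\<^sub>F t in at_right 0. \<forall>z\<in>weighted_box w t. cmod (f z) \<le> C * t ^ s"
    using assms(1) by (rule vanishesE)
  obtain D where D: "D \<ge> 0" "\<forall>\<^sub>F t in at_right 0. \<forall>z\<in>weighted_box w t. cmod (g z) \<le> D * t ^ s'"
    using assms(2) by (rule vanishesE)
  have "\<forall>\<^sub>F t in at_right 0. \<forall>z\<in>weighted_box w t. cmod (f z * g z) \<le> (C * D) * t ^ (s + s')"
    using C(2) D(2) eventually_at_right_less[of 0]
  proof eventually_elim
    case (elim t)
    show ?case
    proof
      fix z assume "z \<in> weighted_box w t"
      then have "cmod (f z) * cmod (g z) \<le> (C * t ^ s) * (D * t ^ s')"
        using elim C(1) by (intro mult_mono) auto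
      then show "cmod (f z * g z) \<le> (C * D) * t ^ (s + s')"
        by (simp add: norm_mult power_add mult_ac)
    qed
  qed
  then show ?thesis unfolding vanishes_def by blast
qed

lemma vanishes_cmult: "vanishes w s f \<Longrightarrow> vanishes w s (\<lambda>z. c * f z)"
  using vanishes_mult[OF vanishes_const] by simp

lemma vanishes_diff: "vanishes w s f \<Longrightarrow> vanishes w s g \<Longrightarrow> vanishes w s (\<lambda>z. f z - g z)"
  using vanishes_add[OF _ vanishes_cmult[of w s g "-1"], of f] by simp

lemma vanishes_sum: "(\<And>i. i \<in> I \<Longrightarrow> vanishes w s (f i)) \<Longrightarrow> vanishes w s (\<lambda>z. \<Sum>i\<in>I. f i z)"
  by (induction I rule: infinite_finite_induct) (auto intro: vanishes_add)

lemma vanishes_mono: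
  assumes "vanishes w s f" "s' \<le> s"
  shows "vanishes w s' f"
proof -
  obtain C where C: "C \<ge> 0" "\<forall>\<^sub>F t in at_right 0. \<forall>z\<in>weighted_box w t. cmod (f z) \<le> C * t ^ s"
    using assms(1) by (rule vanishesE)
  have "\<forall>\<^sub>F t in at_right (0::real). t < 1" by (intro eventually_at_rightI[of 0 1]) auto
  with C(2) eventually_at_right_less[of 0]
  have "\<forall>\<^sub>F t in at_right 0. \<forall>z\<in>weighted_box w t. cmod (f z) \<le> C * t ^ s'"
  proof eventually_elim
    case (elim t)
    have "C * t ^ s \<le> C * t ^ s'" using elim C(1) assms(2) by (intro mult_left_mono power_decreasing) auto
    then show ?case using elim(1) by (meson order_trans)
  qed
  then show ?thesis unfolding vanishes_def by blast
qed

lemma vanishes_prod: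
  "(\<And>i. i \<in> I \<Longrightarrow> vanishes w (a i) (f i)) \<Longrightarrow> vanishes w (sum a I) (\<lambda>z. \<Prod>i\<in>I. f i z)"
  by (induction I rule: infinite_finite_induct) (auto intro: vanishes_mult vanishes_const)

text \<open>
  A product changes only in heavier terms if each factor does; this is how the action of \<open>C\<close> on the
  coordinates determines its action on monomials.
\<close>

lemma vanishes_prod_diff:
  assumes "\<And>i. i \<in> I \<Longrightarrow> vanishes w (a i) (f i)" "\<And>i. i \<in> I \<Longrightarrow> vanishes w (a i) (g i)"
    and "\<And>i. i \<in> I \<Longrightarrow> vanishes w (a i + 1) (\<lambda>z. f i z - g i z)"
  shows "vanishes w (sum a I + 1) (\<lambda>z. (\<Prod>i\<in>I. f i z) - (\<Prod>i\<in>I. g i z))"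
  using assms
proof (induction I rule: infinite_finite_induct)
  case (insert x I)
  have "vanishes w (a x + (sum a I + 1)) (\<lambda>z. f x z * ((\<Prod>i\<in>I. f i z) - (\<Prod>i\<in>I. g i z)))"
    using insert by (intro vanishes_mult) auto
  moreover have "vanishes w ((a x + 1) + sum a I) (\<lambda>z. (f x z - g x z) * (\<Prod>i\<in>I. g i z))"
    using insert by (intro vanishes_mult vanishes_prod) auto
  ultimately have "vanishes w (a x + sum a I + 1)
      (\<lambda>z. f x z * ((\<Prod>i\<in>I. f i z) - (\<Prod>i\<in>I. g i z)) + (f x z - g x z) * (\<Prod>i\<in>I. g i z))"
    by (intro vanishes_add) (simp_all add: add_ac)
  then show ?case using insert by (simp add: algebra_simps)
qed auto

text \<open>
  The value \<open>t = 0\<close> is left out so that a power of \<open>t\<close> can be cancelled when the identity is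
  differentiated; at \<open>0\<close> one argues by continuity.
\<close>

definition quasihomogeneous :: "('n \<Rightarrow> nat) \<Rightarrow> nat \<Rightarrow> (complex^'n \<Rightarrow> complex) \<Rightarrow> bool" where
  "quasihomogeneous w s G \<longleftrightarrow> (\<forall>t z. t \<noteq> 0 \<longrightarrow> G (dilation w t z) = t ^ s * G z)"

lemma finite_weight_eq:
  assumes "\<And>l. w l > 0"
  shows "finite {p :: nat^'n. weight w p = s}"
proof (rule finite_subset)
  show "{p. weight w p = s} \<subseteq> (\<lambda>f. \<chi> l. f l) ` (UNIV \<rightarrow>\<^sub>E {..s})"
  proof
    fix p :: "nat^'n" assume "p \<in> {p. weight w p = s}"
    then have s: "weight w p = s" by simp
    have "p $ l \<le> s" for l
    proof -
      have "p $ l \<le> w l * p $ l" using assms[of l] by simp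
      also have "\<dots> \<le> weight w p" unfolding weight_def by (intro member_le_sum) auto
      finally show ?thesis using s by simp
    qed
    then show "p \<in> (\<lambda>f. \<chi> l. f l) ` (UNIV \<rightarrow>\<^sub>E {..s})"
      by (intro image_eqI[of _ _ "\<lambda>l. p $ l"]) (auto simp: vec_eq_iff)
  qed
qed (intro finite_imageI finite_PiE; simp)

lemma entire_quasihomogeneous_0:
  assumes w: "\<And>l. w l > 0" and G: "entire G"
  shows "((\<lambda>t. G (dilation w t z)) \<longlongrightarrow> G 0) (at 0)"
proof -
  have "isCont (\<lambda>t. G (dilation w t z)) 0"
    by (rule continuous_on_interior[of UNIV])
       (auto simp: dilation_def intro!: continuous_on_compose2[OF entire_continuous_on[OF G, of UNIV]] continuous_intros)
  moreover have "dilation w 0 z = 0" using w by (simp add: vec_eq_iff zero_power)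
  ultimately show ?thesis by (simp add: isCont_def)
qed

lemma quasihomogeneous_partial:
  assumes G: "entire G" and qh: "quasihomogeneous w s G" and t: "t \<noteq> 0"
  shows "t ^ w l * differential G (dilation w t z) (axis l 1) = t ^ s * differential G z (axis l 1)"
proof -
  have "bounded_linear (dilation w t)"
    unfolding linear_conv_bounded_linear[symmetric]
    by (rule linearI) (auto simp: vec_eq_iff algebra_simps scaleR_conv_of_real)
  then have d: "(dilation w t has_derivative dilation w t) (at z)"
    by (rule bounded_linear_imp_has_derivative)
  have 1: "((\<lambda>z. G (dilation w t z)) has_derivative (\<lambda>v. differential G (dilation w t z) (dilation w t v))) (at z)"
    using has_derivative_compose[OF d entire_differential(1)[OF G]] .
  have "(\<lambda>z. G (dilation w t z)) = (\<lambda>z. t ^ s * G z)"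
    using qh t by (auto simp: quasihomogeneous_def)
  then have 2: "((\<lambda>z. G (dilation w t z)) has_derivative (\<lambda>v. t ^ s * differential G z v)) (at z)"
    by (auto intro!: has_derivative_mult_right entire_differential[OF G])
  have "dilation w t (axis l 1) = t ^ w l *s axis l 1" by (auto simp: vec_eq_iff axis_def)
  then show ?thesis
    using fun_cong[OF has_derivative_unique[OF 1 2], of "axis l 1"] by (simp add: entire_differential(2)[OF G])
qed

lemma euler_identity:
  assumes G: "entire G" and qh: "quasihomogeneous w s G"
  shows "(\<Sum>l\<in>UNIV. of_nat (w l) * z $ l * differential G z (axis l 1)) = of_nat s * G z"
proof -
  let ?c = "\<chi> l. of_nat (w l) * z $ l"
  have "((\<lambda>t. G (dilation w t z)) has_field_derivative differential G (dilation w 1 z) ?c) (at 1)"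
    by (rule entire_along_curve[OF G]) (auto intro!: derivative_eq_intros)
  then have 1: "((\<lambda>t. G (dilation w t z)) has_field_derivative differential G z ?c) (at 1)" by simp
  have "((\<lambda>t. t ^ s * G z) has_field_derivative of_nat s * G z) (at 1)"
    by (auto intro!: derivative_eq_intros)
  then have 2: "((\<lambda>t. G (dilation w t z)) has_field_derivative of_nat s * G z) (at 1)"
  proof (rule has_field_derivative_transform_within[of _ _ _ _ 1])
    fix t :: complex assume "dist t 1 < 1"
    then have "t \<noteq> 0" by auto
    then show "t ^ s * G z = G (dilation w t z)" using qh by (simp add: quasihomogeneous_def)
  qed auto
  have "differential G z ?c = of_nat s * G z" using DERIV_unique[OF 1 2] .
  then show ?thesis by (simp add: differential_sum_axis[OF G, of z ?c])
qed

definition polynomial_of_weight :: "('n \<Rightarrow> nat) \<Rightarrow> nat \<Rightarrow> (complex^'n \<Rightarrow> complex) \<Rightarrow> bool" where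
  "polynomial_of_weight w s G \<longleftrightarrow> (\<exists>c. \<forall>z. G z = (\<Sum>p | weight w p = s. c p * mono_pow z p))"

lemma polynomial_of_weight_sum:
  assumes "\<And>i. i \<in> I \<Longrightarrow> polynomial_of_weight w s (G i)"
  shows "polynomial_of_weight w s (\<lambda>z. \<Sum>i\<in>I. G i z)"
proof -
  obtain c where c: "\<And>i z. i \<in> I \<Longrightarrow> G i z = (\<Sum>p | weight w p = s. c i p * mono_pow z p)"
    using assms unfolding polynomial_of_weight_def by metis
  have "(\<Sum>i\<in>I. G i z) = (\<Sum>p | weight w p = s. (\<Sum>i\<in>I. c i p) * mono_pow z p)" for z
    by (simp add: c sum_distrib_right sum.swap[of _ _ I])
  then show ?thesis unfolding polynomial_of_weight_def by (intro exI[of _ "\<lambda>p. \<Sum>i\<in>I. c i p"]) simp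
qed

lemma polynomial_of_weight_monomial:
  assumes w: "\<And>l. w l > 0" and p: "weight w p = s"
  shows "polynomial_of_weight w s (\<lambda>z. a * mono_pow z p)"
  unfolding polynomial_of_weight_def
proof (intro exI allI)
  fix z
  show "a * mono_pow z p = (\<Sum>q | weight w q = s. (if q = p then a else 0) * mono_pow z q)"
    using p finite_weight_eq[of w s, OF w] by (simp add: if_distrib[of "\<lambda>x. x * _"] cong: if_cong)
qed

lemma weight_add_axis: "weight w (p + axis l 1) = weight w p + w l"
  by (simp add: weight_def axis_def algebra_simps sum.distrib if_distrib[of "\<lambda>x. _ * x"] cong: if_cong)

lemma mono_pow_add_axis: "mono_pow z (p + axis l 1) = z $ l * mono_pow z p"
proof -
  have "mono_pow z (p + axis l 1) = (\<Prod>i\<in>UNIV. (if i = l then z $ i else 1) * z $ i ^ (p $ i))"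
    unfolding mono_pow_def by (intro prod.cong) (auto simp: axis_def)
  then show ?thesis by (simp add: prod.distrib mono_pow_def)
qed

lemma entire_mono_pow [intro]: "entire (\<lambda>z. mono_pow z p)"
  unfolding mono_pow_def by (intro entire_prod entire_power entire_coord)

text \<open>
  By Euler's identity \<open>s G = \<Sum>\<^sub>l w\<^sub>l z\<^sub>l \<partial>\<^sub>l G\<close>, and \<open>\<partial>\<^sub>l G\<close> is quasi-homogeneous of the smaller weight
  \<open>s - w\<^sub>l\<close>, or zero if \<open>w\<^sub>l > s\<close>. So the claim follows by induction on the weight, from the constants.
\<close>

lemma quasihomogeneous_imp_polynomial:
  assumes w: "\<And>l. w l > 0" and "entire G" "quasihomogeneous w s G"
  shows "polynomial_of_weight w s G"
  using assms(2,3)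
proof (induction s arbitrary: G rule: less_induct)
  case (less s)
  note G = less.prems(1) and qh = less.prems(2)
  show ?case
  proof (cases "s = 0")
    case True
    have "G z = G 0" for z
    proof -
      have "\<forall>\<^sub>F t in at 0. G (dilation w t z) = G z"
        using qh True by (auto simp: quasihomogeneous_def eventually_at_filter)
      then have "((\<lambda>t. G (dilation w t z)) \<longlongrightarrow> G z) (at 0)"
        by (rule tendsto_eventually)
      from LIM_unique[OF this entire_quasihomogeneous_0[OF w G]] show ?thesis .
    qed
    moreover have "polynomial_of_weight w 0 (\<lambda>z. G 0 * mono_pow z 0)"
      by (rule polynomial_of_weight_monomial[OF w]) (simp add: weight_def)
    ultimately show ?thesis using True by (metis (no_types, lifting) ext mono_pow_def mult.right_neutral power_0 prod.neutral_const zero_index)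
  next
    case False
    let ?D = "\<lambda>l z. differential G z (axis l 1)"
    have D: "entire (?D l)" for l by (rule entire_partial[OF G])
    have "polynomial_of_weight w s (\<lambda>z. of_nat (w l) / of_nat s * z $ l * ?D l z)" for l
    proof (cases "w l \<le> s")
      case True
      have "quasihomogeneous w (s - w l) (?D l)"
        unfolding quasihomogeneous_def
      proof (intro allI impI)
        fix t :: complex and z :: "complex^'a" assume t: "t \<noteq> 0"
        have "t ^ s = t ^ w l * t ^ (s - w l)" using True by (simp add: power_add[symmetric])
        then show "?D l (dilation w t z) = t ^ (s - w l) * ?D l z"
          using quasihomogeneous_partial[OF G qh t, of l z] t by simp
      qed
      then have "polynomial_of_weight w (s - w l) (?D l)"
        using True w[of l] False by (intro less.IH D) auto
      then obtain c where c: "\<And>z. ?D l z = (\<Sum>p | weight w p = s - w l. c p * mono_pow z p)"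
        unfolding polynomial_of_weight_def by blast
      have "polynomial_of_weight w s (\<lambda>z. \<Sum>p | weight w p = s - w l.
          (of_nat (w l) / of_nat s * c p) * mono_pow z (p + axis l 1))"
        by (intro polynomial_of_weight_sum polynomial_of_weight_monomial w)
           (use True weight_add_axis[of w] in auto)
      moreover have "of_nat (w l) / of_nat s * z $ l * ?D l z = (\<Sum>p | weight w p = s - w l.
          (of_nat (w l) / of_nat s * c p) * mono_pow z (p + axis l 1))" for z
        unfolding c mono_pow_add_axis sum_distrib_left by (intro sum.cong refl) algebra
      ultimately show ?thesis by simp
    next
      case False
      have "?D l z = 0" for z
      proof -
        have lim: "((\<lambda>t. t ^ (w l - s) * ?D l (dilation w t z)) \<longlongrightarrow> 0 ^ (w l - s) * ?D l 0) (at 0)"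
          by (intro tendsto_intros entire_quasihomogeneous_0 w D)
        have "t ^ (w l - s) * ?D l (dilation w t z) = ?D l z" if t: "t \<noteq> 0" for t
        proof -
          have "t ^ w l = t ^ s * t ^ (w l - s)" using False by (simp add: power_add[symmetric])
          then show ?thesis using quasihomogeneous_partial[OF G qh t, of l z] t by simp
        qed
        then have "\<forall>\<^sub>F t in at 0. t ^ (w l - s) * ?D l (dilation w t z) = ?D l z"
          by (auto simp: eventually_at_filter)
        then have "((\<lambda>t. t ^ (w l - s) * ?D l (dilation w t z)) \<longlongrightarrow> ?D l z) (at 0)"
          by (rule tendsto_eventually)
        from LIM_unique[OF this lim] have "?D l z = 0 ^ (w l - s) * ?D l 0" .
        then show ?thesis using False by (simp add: zero_power)
      qed
      moreover have "polynomial_of_weight w s (\<lambda>z. 0)"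
        using polynomial_of_weight_sum[of "{}" w s] by simp
      ultimately show ?thesis by simp
    qed
    then have "polynomial_of_weight w s (\<lambda>z. \<Sum>l\<in>UNIV. of_nat (w l) / of_nat s * z $ l * ?D l z)"
      by (rule polynomial_of_weight_sum)
    moreover have "(\<Sum>l\<in>UNIV. of_nat (w l) / of_nat s * z $ l * ?D l z) = G z" for z
    proof -
      have "(\<Sum>l\<in>UNIV. of_nat (w l) / of_nat s * z $ l * ?D l z)
          = (\<Sum>l\<in>UNIV. of_nat (w l) * z $ l * ?D l z) / of_nat s"
        by (simp add: sum_divide_distrib)
      then show ?thesis using False by (simp add: euler_identity[OF G qh])
    qed
    ultimately show ?thesis by simp
  qed
qed

text \<open>
  Along the weighted curves \<open>t \<mapsto> (t\<^bsup>w l\<^esup> z\<^sub>l)\<close> the function \<open>f\<close> has an ordinary power series in \<open>t\<close>, whose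
  \<open>k\<close>-th coefficient is, as a function of \<open>z\<close>, entire and quasi-homogeneous of weight \<open>k\<close>, hence a
  polynomial. Vanishing to weight \<open>s\<close> kills the coefficients below \<open>s\<close>.
\<close>

theorem weighted_taylor:
  fixes f :: "complex^'n \<Rightarrow> complex"
  assumes w: "\<And>l. w l > 0" and f: "entire f" and v: "vanishes w s f"
  shows "\<exists>c. vanishes w (s + 1) (\<lambda>z. f z - (\<Sum>p | weight w p = s. c p * mono_pow z p))"
proof -
  define F where "F k z = taylor_coeff k (\<lambda>t. f (dilation w t z))" for k z
  have hol: "(\<lambda>t. f (dilation w t z)) holomorphic_on UNIV" for z
  proof -
    have "((\<lambda>t. f (dilation w t z)) has_field_derivative
        differential f (dilation w t z) (\<chi> l. of_nat (w l) * t ^ (w l - 1) * z $ l)) (at t)" for t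
      by (rule entire_along_curve[OF f]) (auto intro!: derivative_eq_intros)
    then show ?thesis by (auto simp: holomorphic_on_open)
  qed
  have bd: "\<exists>B. \<forall>z\<in>cball 0 R. \<forall>t\<in>cball 0 1. cmod (f (dilation w t z)) \<le> B" for R
    by (rule bounded_on_compact_family)
       (auto simp: case_prod_unfold dilation_def intro!: continuous_on_compose2[OF entire_continuous_on[OF f, of UNIV]] continuous_intros)
  have F: "entire (F k)" for k
    unfolding F_def
  proof (rule entire_taylor_coeff[OF hol _ bd])
    show "entire (\<lambda>z. f (dilation w t z))" for t
      by (rule entire_compose[OF f]) auto
  qed
  have F_dil: "F k (dilation w u z) = u ^ k * F k z" for k u z
    using higher_deriv_compose_linear[OF hol open_UNIV open_UNIV, of 0 u k z]
    by (simp add: F_def taylor_coeff_def dilation_dilation mult.commute[of _ u])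
  then have "quasihomogeneous w s (F s)" by (simp add: quasihomogeneous_def)
  then obtain c where c: "\<And>z. F s z = (\<Sum>p | weight w p = s. c p * mono_pow z p)"
    using quasihomogeneous_imp_polynomial[of w "F s" s, OF w F] unfolding polynomial_of_weight_def by blast
  have F0: "F j z = 0" if "j < s" for j z
  proof -
    obtain B where "\<forall>u\<in>cball 0 (norm z). \<forall>t\<in>cball 0 1. cmod (f (dilation w t u)) \<le> B" using bd by blast
    then have B: "\<And>t. cmod t \<le> 1 \<Longrightarrow> cmod (f (dilation w t z)) \<le> B" by auto
    obtain C where C: "\<forall>\<^sub>F t in at_right 0. \<forall>z\<in>weighted_box w t. cmod (f z) \<le> C * t ^ s"
      using v by (rule vanishesE)
    define r where "r = 1 + norm z"
    have r: "r \<ge> 1" by (simp add: r_def)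
    have lim: "filterlim (\<lambda>t. t * r) (at_right 0) (at_right 0)"
    proof (rule filterlim_at_withinI)
      show "((\<lambda>t. t * r) \<longlongrightarrow> 0) (at_right 0)"
        by (rule tendsto_mult_left_zero) (rule tendsto_ident_at)
      show "\<forall>\<^sub>F t in at_right 0. t * r \<in> {0<..} - {0}"
        using eventually_at_right_less[of 0] by eventually_elim (use r in simp)
    qed
    have "\<forall>\<^sub>F t in at_right 0. cmod (f (dilation w (of_real t) z)) \<le> (C * r ^ s) * t ^ s"
      using filterlim_iff[THEN iffD1, OF lim, rule_format, OF C] eventually_at_right_less[of 0]
    proof eventually_elim
      case (elim t)
      have "cmod (z $ l) \<le> r ^ w l" for l
      proof -
        have "cmod (z $ l) \<le> r ^ 1" using norm_vec_nth_le[of z l] by (simp add: r_def)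
        also have "\<dots> \<le> r ^ w l" using r w[of l] by (intro power_increasing) auto
        finally show ?thesis .
      qed
      then have "dilation w (of_real t) z \<in> weighted_box w (t * r)"
        using elim by (auto simp: weighted_box_def norm_mult norm_power power_mult_distrib mult_left_mono)
      then show ?case using elim by (auto simp: power_mult_distrib mult_ac)
    qed
    from taylor_coeff_eq_0[OF hol B this that] show ?thesis by (simp add: F_def)
  qed
  have "vanishes w (s + 1) (\<lambda>z. f z - F s z)"
  proof -
    obtain B where B: "\<forall>u\<in>cball 0 (real CARD('n)). \<forall>t\<in>cball 0 1. cmod (f (dilation w t u)) \<le> B" using bd by blast
    have half: "\<forall>\<^sub>F t in at_right (0::real). t < 1/2" by (intro eventually_at_rightI[of 0 "1/2"]) auto
    have "\<forall>\<^sub>F t in at_right 0. \<forall>z\<in>weighted_box w t. cmod (f z - F s z) \<le> 2 * B * t ^ (s + 1)"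
      using half eventually_at_right_less[of 0]
    proof eventually_elim
      case (elim t)
      show ?case
      proof
        fix z assume z: "z \<in> weighted_box w t"
        define u where "u = dilation w (inverse (of_real t)) z"
        have zu: "z = dilation w (of_real t) u" using elim by (simp add: u_def dilation_dilation)
        have u1: "cmod (u $ l) \<le> 1" for l
        proof -
          have "cmod (z $ l) \<le> t ^ w l" using z by (simp add: weighted_box_def)
          then show ?thesis
            using elim by (simp add: u_def norm_mult norm_power norm_inverse power_inverse) (simp add: field_simps)
        qed
        have "norm u \<le> (\<Sum>l\<in>UNIV. cmod (u $ l))" unfolding norm_vec_def by (rule L2_set_le_sum) auto
        also have "\<dots> \<le> (\<Sum>l\<in>(UNIV::'n set). 1)" by (intro sum_mono u1)
        finally have "norm u \<le> CARD('n)" by simp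
        then have Bu: "\<And>t. cmod t \<le> 1 \<Longrightarrow> cmod (f (dilation w t u)) \<le> B" using B by auto
        have "(\<Sum>j<Suc s. taylor_coeff j (\<lambda>t. f (dilation w t u)) * of_real t ^ j) = F s z"
          unfolding F_def[symmetric] zu F_dil by (simp add: F0)
        then show "cmod (f z - F s z) \<le> 2 * B * t ^ (s + 1)"
          using taylor_remainder[OF hol Bu, where t = "of_real t" and k = "Suc s"] elim zu by simp
      qed
    qed
    then show ?thesis unfolding vanishes_def by blast
  qed
  then show ?thesis using c by auto
qed

section \<open>The composition operator of a triangular contraction\<close>

text \<open>
  The Taylor remainder of order \<open>2\<close> of the restriction of \<open>f\<close> to the complex line through \<open>0\<close> and \<open>z\<close>.
\<close>

lemma entire_quadratic_remainder:
  fixes f :: "complex^'n \<Rightarrow> complex"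
  assumes f: "entire f"
  obtains B where "0 \<le> B" "\<And>z. norm z \<le> 1/2 \<Longrightarrow> cmod (f z - f 0 - differential f 0 z) \<le> B * (norm z)\<^sup>2"
proof -
  have "compact (f ` cball 0 1)" by (intro compact_continuous_image entire_continuous_on f) auto
  then have "bounded (f ` cball 0 1)" by (rule compact_imp_bounded)
  then obtain B where "\<forall>x\<in>f ` cball 0 1. norm x \<le> B" unfolding bounded_iff ..
  then have B: "\<And>z. norm z \<le> 1 \<Longrightarrow> cmod (f z) \<le> B" by auto
  have B0: "0 \<le> B" using order_trans[OF norm_ge_zero B[of 0]] by simp
  have "cmod (f z - f 0 - differential f 0 z) \<le> 2 * B * (norm z)\<^sup>2" if z: "norm z \<le> 1/2" for z
  proof (cases "z = 0")
    case True
    have "differential f 0 0 = 0" using entire_differential(2)[OF f, of 0 0 0] by simp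
    then show ?thesis using True by simp
  next
    case False
    define u where "u = complex_of_real (inverse (norm z)) *s z"
    have u: "norm u = 1" and zu: "z = complex_of_real (norm z) *s u"
      using False by (auto simp: u_def norm_vector_smult norm_inverse vec_eq_iff)
    let ?g = "\<lambda>t. f (t *s u)"
    have d: "(?g has_field_derivative differential f (t *s u) u) (at t)" for t
      using entire_along_line[OF f, of 0] by simp
    have hol: "?g holomorphic_on UNIV" using d by (auto simp: holomorphic_on_open)
    have gB: "cmod (?g t) \<le> B" if "cmod t \<le> 1" for t
      using that u by (intro B) (simp add: norm_vector_smult)
    have "cmod (?g (norm z) - (\<Sum>j<2. taylor_coeff j ?g * of_real (norm z) ^ j)) \<le> 2 * B * cmod (norm z) ^ 2"
      by (rule taylor_remainder[OF hol gB]) (use z in auto)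
    moreover have "(\<Sum>j<2. taylor_coeff j ?g * of_real (norm z) ^ j) = f 0 + norm z * differential f 0 u"
      using DERIV_imp_deriv[OF d[of 0]] by (simp add: numeral_2_eq_2 taylor_coeff_def)
    moreover have "norm z * differential f 0 u = differential f 0 z"
      using entire_differential(2)[OF f, of 0 "of_real (norm z)" u] zu by simp
    moreover have "?g (norm z) = f z" using zu by simp
    ultimately show ?thesis by (simp add: diff_diff_eq)
  qed
  then show ?thesis using B0 by (intro that[of "2 * B"]) auto
qed

lemma vanishes_power_diff:
  assumes "vanishes w a F" "vanishes w a G" "vanishes w (a + 1) (\<lambda>z. F z - G z)"
  shows "vanishes w (a * k + 1) (\<lambda>z. F z ^ k - G z ^ k)"
  using vanishes_prod_diff[of "{..<k}" w "\<lambda>_. a" "\<lambda>_. F" "\<lambda>_. G"] assms by (simp add: mult.commute)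

lemma vanishes_power: "vanishes w a F \<Longrightarrow> vanishes w (a * k) (\<lambda>z. F z ^ k)"
  using vanishes_prod[of "{..<k}" w "\<lambda>_. a" "\<lambda>_. F"] by (simp add: mult.commute)

lemma vanishes_mono_pow_diff:
  assumes F: "\<And>l. vanishes w (w l) (\<lambda>z. F z $ l)" and G: "\<And>l. vanishes w (w l) (\<lambda>z. G z $ l)"
    and FG: "\<And>l. vanishes w (w l + 1) (\<lambda>z. F z $ l - G z $ l)"
  shows "vanishes w (weight w p + 1) (\<lambda>z. mono_pow (F z) p - mono_pow (G z) p)"
  unfolding mono_pow_def weight_def
  by (intro vanishes_prod_diff vanishes_power vanishes_power_diff assms)

text \<open>
  A contraction in coordinates in which its differential at \<open>0\<close> is lower triangular with the
  eigenvalues in the prescribed order.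
\<close>

locale triangular_contraction =
  fixes \<gamma> :: "'n::{finite,linorder} cvec \<Rightarrow> 'n cvec" and T :: "('n cvec, 'n) vec" and \<beta> :: "'n cvec"
  assumes \<gamma>_entire: "\<And>l. entire (\<lambda>z. \<gamma> z $ l)"
    and \<gamma>_0: "\<gamma> 0 = 0"
    and \<gamma>_deriv: "(\<gamma> has_derivative (\<lambda>v. T *v v)) (at 0)"
    and T_lower: "\<And>i j. i < j \<Longrightarrow> T $ i $ j = 0" and T_diag: "\<And>i. T $ i $ i = \<beta> $ i"
    and \<beta>_pos: "\<And>j. 0 < cmod (\<beta> $ j)" and \<beta>_less: "\<And>j. cmod (\<beta> $ j) < 1"
    and \<beta>_ord: "\<And>i j. i \<le> j \<Longrightarrow> cmod (\<beta> $ j) \<le> cmod (\<beta> $ i)"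
    and \<gamma>_contr: "\<And>K U. compact K \<Longrightarrow> open U \<Longrightarrow> 0 \<in> U \<Longrightarrow> \<forall>\<^sub>F N in sequentially. (\<gamma> ^^ N) ` K \<subseteq> U"
begin

text \<open>
  Two properties are needed: the weights strictly decrease along the order, so that the entries of
  \<open>T\<close> below the diagonal contribute only heavier terms, and \<open>wt l + 1 \<le> 2 CARD('n)\<close>, so that
  quadratic terms are heavier than every coordinate.
\<close>

definition wt :: "'n \<Rightarrow> nat" where "wt l = CARD('n) + card {i. l < i}"

lemma wt_pos: "wt l > 0" by (simp add: wt_def)

lemma wt_less: "wt l + 1 \<le> wt i" if "i < l"
proof -
  have "{k. l < k} \<subset> {k. i < k}" using that by auto
  from psubset_card_mono[OF _ this] show ?thesis by (simp add: wt_def)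
qed

lemma wt_antimono: "i \<le> l \<Longrightarrow> wt l \<le> wt i"
  using wt_less[of i l] by (cases "i = l") (auto simp: order.order_iff_strict)

lemma wt_lt: "wt l + 1 \<le> 2 * CARD('n)"
proof -
  have "{i. l < i} \<subset> UNIV" by auto
  from psubset_card_mono[OF _ this] show ?thesis by (simp add: wt_def)
qed

lemma differential_\<gamma>: "differential (\<lambda>z. \<gamma> z $ l) 0 v = (T *v v) $ l"
proof -
  have "((\<lambda>z. \<gamma> z $ l) has_derivative (\<lambda>v. (T *v v) $ l)) (at 0)"
    by (rule bounded_linear.has_derivative[OF bounded_linear_vec_nth \<gamma>_deriv])
  from frechet_derivative_at[OF this] show ?thesis by metis
qed

lemma vanishes_quadratic:
  assumes B: "0 \<le> B" "\<And>z. norm z \<le> 1/2 \<Longrightarrow> cmod (f z) \<le> B * (norm z)\<^sup>2"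
  shows "vanishes wt (2 * CARD('n)) f"
proof -
  let ?n = "CARD('n)"
  have lim: "((\<lambda>t. real ?n * t ^ ?n) \<longlongrightarrow> real ?n * 0 ^ ?n) (at_right 0)" by (intro tendsto_intros)
  then have "\<forall>\<^sub>F t in at_right (0::real). real ?n * t ^ ?n < 1/2"
    by (rule order_tendstoD) (simp add: zero_power)
  moreover have "\<forall>\<^sub>F t in at_right (0::real). t < 1" by (intro eventually_at_rightI[of 0 1]) auto
  ultimately have "\<forall>\<^sub>F t in at_right 0. \<forall>z\<in>weighted_box wt t. cmod (f z) \<le> (B * (real ?n)\<^sup>2) * t ^ (2 * ?n)"
    using eventually_at_right_less[of 0]
  proof eventually_elim
    case (elim t)
    show ?case
    proof
      fix z :: "'n cvec" assume z: "z \<in> weighted_box wt t"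
      have "norm z \<le> (\<Sum>l\<in>UNIV. cmod (z $ l))" unfolding norm_vec_def by (rule L2_set_le_sum) auto
      also have "\<dots> \<le> (\<Sum>l\<in>(UNIV::'n set). t ^ ?n)"
      proof (rule sum_mono)
        fix l
        have "cmod (z $ l) \<le> t ^ wt l" using z by (simp add: weighted_box_def)
        also have "\<dots> \<le> t ^ ?n" using elim by (intro power_decreasing) (auto simp: wt_def)
        finally show "cmod (z $ l) \<le> t ^ ?n" .
      qed
      finally have nz: "norm z \<le> real ?n * t ^ ?n" by simp
      then have "cmod (f z) \<le> B * (norm z)\<^sup>2" using elim by (intro B) linarith
      also have "\<dots> \<le> B * (real ?n * t ^ ?n)\<^sup>2" using nz B by (intro mult_left_mono power_mono) auto
      finally show "cmod (f z) \<le> (B * (real ?n)\<^sup>2) * t ^ (2 * ?n)"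
        by (simp add: power_mult_distrib power_mult[symmetric] mult_ac)
    qed
  qed
  then show ?thesis unfolding vanishes_def by blast
qed

lemma \<gamma>_leading: "vanishes wt (wt l + 1) (\<lambda>z. \<gamma> z $ l - \<beta> $ l * z $ l)"
proof -
  obtain B where B: "0 \<le> B"
    "\<And>z. norm z \<le> 1/2 \<Longrightarrow> cmod (\<gamma> z $ l - \<gamma> 0 $ l - differential (\<lambda>z. \<gamma> z $ l) 0 z) \<le> B * (norm z)\<^sup>2"
    using entire_quadratic_remainder[OF \<gamma>_entire] by blast
  have "vanishes wt (2 * CARD('n)) (\<lambda>z. \<gamma> z $ l - (T *v z) $ l)"
    by (rule vanishes_quadratic[OF B(1)]) (use B(2) in \<open>simp add: differential_\<gamma> \<gamma>_0\<close>)
  then have 1: "vanishes wt (wt l + 1) (\<lambda>z. \<gamma> z $ l - (T *v z) $ l)"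
    using wt_lt vanishes_mono by blast
  have "vanishes wt (wt l + 1) (\<lambda>z. T $ l $ i * z $ i)" if "i \<noteq> l" for i
  proof (cases "i < l")
    case True
    then show ?thesis by (intro vanishes_cmult vanishes_mono[OF vanishes_coord wt_less])
  qed (use that T_lower[of l i] in auto)
  then have 2: "vanishes wt (wt l + 1) (\<lambda>z. \<Sum>i\<in>UNIV - {l}. T $ l $ i * z $ i)"
    by (intro vanishes_sum) auto
  have "(T *v z) $ l = \<beta> $ l * z $ l + (\<Sum>i\<in>UNIV - {l}. T $ l $ i * z $ i)" for z
    unfolding matrix_vector_mult_def by (simp add: sum.remove[of UNIV l] T_diag)
  then show ?thesis using vanishes_add[OF 1 2] by simp
qed

lemma \<gamma>_vanishes: "vanishes wt (wt l) (\<lambda>z. \<gamma> z $ l)"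
  using vanishes_add[OF vanishes_mono[OF \<gamma>_leading[of l], of "wt l"] vanishes_cmult[OF vanishes_coord, where c = "\<beta> $ l"]] by simp

text \<open>
  On the box of size \<open>t\<close> the leading term of \<open>\<gamma>\<^sub>l\<close> is at most \<open>|\<beta>\<^sub>l| t\<^bsup>wt l\<^esup>\<close> and the rest is
  \<open>O(t\<^bsup>wt l + 1\<^esup>)\<close>, so any \<open>\<theta> < 1\<close> with \<open>|\<beta>\<^sub>l| < \<theta>\<^bsup>wt l\<^esup>\<close> for all \<open>l\<close> works. In a norm of \<open>\<complex>\<^sup>n\<close> that is
  unrelated to \<open>T\<close> such a contraction may hold only for high iterates.
\<close>

lemma contraction_of_boxes:
  obtains \<theta> where "0 < \<theta>" "\<theta> < 1"
    "\<forall>\<^sub>F t in at_right 0. \<forall>z\<in>weighted_box wt t. \<gamma> z \<in> weighted_box wt (\<theta> * t)"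
proof -
  have "\<forall>\<^sub>F \<theta> in at_left (1::real). \<forall>l. cmod (\<beta> $ l) < \<theta> ^ wt l"
  proof (rule eventually_all_finite)
    fix l
    have "((\<lambda>\<theta>. \<theta> ^ wt l) \<longlongrightarrow> 1 ^ wt l) (at_left (1::real))" by (intro tendsto_intros)
    then show "\<forall>\<^sub>F \<theta> in at_left (1::real). cmod (\<beta> $ l) < \<theta> ^ wt l"
      by (rule order_tendstoD) (simp add: \<beta>_less)
  qed
  moreover have "\<forall>\<^sub>F \<theta> in at_left (1::real). 0 < \<theta> \<and> \<theta> < 1"
    by (intro eventually_at_leftI[of 0 1]) auto
  ultimately have "\<forall>\<^sub>F \<theta> in at_left (1::real). 0 < \<theta> \<and> \<theta> < 1 \<and> (\<forall>l. cmod (\<beta> $ l) < \<theta> ^ wt l)"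
    by eventually_elim auto
  then obtain \<theta> :: real where \<theta>: "0 < \<theta>" "\<theta> < 1" and \<beta>\<theta>: "\<And>l. cmod (\<beta> $ l) < \<theta> ^ wt l"
    using eventually_happens'[of "at_left (1::real)"] by auto
  have "\<forall>\<^sub>F t in at_right 0. \<forall>l. \<forall>z\<in>weighted_box wt t. cmod (\<gamma> z $ l) \<le> (\<theta> * t) ^ wt l"
  proof (rule eventually_all_finite)
    fix l
    obtain C where C: "\<forall>\<^sub>F t in at_right 0. \<forall>z\<in>weighted_box wt t. cmod (\<gamma> z $ l - \<beta> $ l * z $ l) \<le> C * t ^ (wt l + 1)"
      using \<gamma>_leading by (rule vanishesE)
    have "((\<lambda>t. C * t) \<longlongrightarrow> C * 0) (at_right 0)" by (intro tendsto_intros)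
    then have "\<forall>\<^sub>F t in at_right 0. C * t < \<theta> ^ wt l - cmod (\<beta> $ l)"
      by (rule order_tendstoD) (use \<beta>\<theta> in simp)
    with C eventually_at_right_less[of 0]
    show "\<forall>\<^sub>F t in at_right 0. \<forall>z\<in>weighted_box wt t. cmod (\<gamma> z $ l) \<le> (\<theta> * t) ^ wt l"
    proof eventually_elim
      case (elim t)
      show ?case
      proof
        fix z assume z: "z \<in> weighted_box wt t"
        have "cmod (\<gamma> z $ l) \<le> cmod (\<gamma> z $ l - \<beta> $ l * z $ l) + cmod (\<beta> $ l * z $ l)"
          using norm_triangle_ineq[of "\<gamma> z $ l - \<beta> $ l * z $ l" "\<beta> $ l * z $ l"] by simp
        also have "\<dots> \<le> C * t ^ (wt l + 1) + cmod (\<beta> $ l) * t ^ wt l"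
          using elim z by (intro add_mono) (auto simp: norm_mult weighted_box_def mult_left_mono)
        also have "\<dots> = (C * t + cmod (\<beta> $ l)) * t ^ wt l" by (simp add: algebra_simps)
        also have "\<dots> \<le> \<theta> ^ wt l * t ^ wt l" using elim by (intro mult_right_mono) auto
        finally show "cmod (\<gamma> z $ l) \<le> (\<theta> * t) ^ wt l" by (simp add: power_mult_distrib)
      qed
    qed
  qed
  then have "\<forall>\<^sub>F t in at_right 0. \<forall>z\<in>weighted_box wt t. \<gamma> z \<in> weighted_box wt (\<theta> * t)"
    by eventually_elim (auto simp: weighted_box_def)
  with \<theta> show ?thesis by (rule that)
qed

lemma entire_iterate: "entire (\<lambda>z. (\<gamma> ^^ i) z $ l)"
  by (induction i arbitrary: l) (auto intro!: entire_compose[OF \<gamma>_entire])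

lemma entire_comp_\<gamma>: "entire f \<Longrightarrow> entire (\<lambda>z. f (\<gamma> z))"
  by (rule entire_compose[OF _ \<gamma>_entire])

text \<open>
  The solution is \<open>h = - \<Sum>\<^sub>i \<mu>\<^sup>-\<^sup>i\<^sup>-\<^sup>1 g \<circ> \<gamma>\<^sup>i\<close>. On a small box \<open>g \<circ> \<gamma>\<^sup>i\<close> decays like \<open>\<theta>\<^bsup>s i\<^esup>\<close>, which beats
  \<open>|\<mu>|\<^sup>-\<^sup>i\<close>; a compact set is mapped into such a box by some iterate of \<open>\<gamma>\<close>, so the convergence is locally
  uniform on all of \<open>\<complex>\<^sup>n\<close>.
\<close>

lemma solve_cohomological:
  assumes box: "\<forall>\<^sub>F t in at_right 0. \<forall>z\<in>weighted_box wt t. \<gamma> z \<in> weighted_box wt (\<theta> * t)"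
    and \<theta>: "0 < \<theta>" "\<theta> < 1"
    and g: "entire g" "vanishes wt s g" and lam: "\<theta> ^ s < cmod \<mu>"
  obtains h where "entire h" "vanishes wt s h" "\<And>z. g z = h (\<gamma> z) - \<mu> * h z"
proof -
  obtain C where C: "0 \<le> C" "\<forall>\<^sub>F t in at_right 0. \<forall>z\<in>weighted_box wt t. cmod (g z) \<le> C * t ^ s"
    using g(2) by (rule vanishesE)
  from eventually_conj[OF box C(2)] obtain \<epsilon> where \<epsilon>: "0 < \<epsilon>"
    and \<epsilon>box: "\<And>t z. 0 < t \<Longrightarrow> t < \<epsilon> \<Longrightarrow> z \<in> weighted_box wt t \<Longrightarrow> \<gamma> z \<in> weighted_box wt (\<theta> * t)"
    and \<epsilon>g: "\<And>t z. 0 < t \<Longrightarrow> t < \<epsilon> \<Longrightarrow> z \<in> weighted_box wt t \<Longrightarrow> cmod (g z) \<le> C * t ^ s"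
    unfolding eventually_at_right_field by auto
  have lam0: "0 < cmod \<mu>" using lam \<theta> by (meson le_less_trans less_imp_le zero_le_power)
  then have lam1: "\<mu> \<noteq> 0" by auto
  define q where "q = \<theta> ^ s / cmod \<mu>"
  have q: "0 < q" "q < 1" using lam lam0 \<theta> by (auto simp: q_def)
  have it: "(\<gamma> ^^ i) z \<in> weighted_box wt (\<theta> ^ i * t)" if t: "0 < t" "t < \<epsilon>" and z: "z \<in> weighted_box wt t" for i t z
  proof (induction i)
    case (Suc i)
    have "\<theta> ^ i * t \<le> 1 * t" using t \<theta> by (intro mult_right_mono power_le_one) auto
    then have "\<theta> ^ i * t < \<epsilon>" using t by linarith
    moreover have "0 < \<theta> ^ i * t" using t \<theta> by simp
    ultimately have "\<theta> ^ i * t < \<epsilon>" "0 < \<theta> ^ i * t" .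
    from \<epsilon>box[OF this(2,1) Suc] show ?case by (simp add: mult_ac)
  qed (use z in simp)
  define a where "a i z = - (g ((\<gamma> ^^ i) z) / \<mu> ^ Suc i)" for i z
  have a_bound: "cmod (a i z) \<le> (C * t ^ s / cmod \<mu>) * q ^ i"
    if t: "0 < t" "t < \<epsilon>" and z: "z \<in> weighted_box wt t" for i t z
  proof -
    have "\<theta> ^ i * t \<le> 1 * t" using t \<theta> by (intro mult_right_mono power_le_one) auto
    then have "\<theta> ^ i * t < \<epsilon>" using t by linarith
    moreover have "0 < \<theta> ^ i * t" using t \<theta> by simp
    ultimately have "\<theta> ^ i * t < \<epsilon>" "0 < \<theta> ^ i * t" .
    from \<epsilon>g[OF this(2,1) it[OF t z]] have "cmod (a i z) \<le> C * (\<theta> ^ i * t) ^ s / cmod \<mu> ^ Suc i"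
      using lam0 by (simp add: a_def norm_divide norm_mult norm_power divide_right_mono)
    also have "\<dots> = (C * t ^ s / cmod \<mu>) * q ^ i"
      by (simp add: q_def power_mult_distrib power_divide power_mult[symmetric] mult.commute[of i])
    finally show ?thesis .
  qed
  have a_shift: "a (i + N) z = a i ((\<gamma> ^^ N) z) / \<mu> ^ N" for i N z
    by (simp add: a_def funpow_add power_add mult_ac)
  define U where "U = {z :: 'n cvec. \<forall>l. cmod (z $ l) < (\<epsilon> / 2) ^ wt l}"
  have U: "open U" unfolding U_def Collect_all_eq
    by (intro open_INT) (auto intro!: open_Collect_less continuous_intros)
  have U0: "0 \<in> U" using \<epsilon> by (simp add: U_def)
  have Ubox: "U \<subseteq> weighted_box wt (\<epsilon> / 2)" by (auto simp: U_def weighted_box_def less_imp_le)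
  define h where "h z = (\<Sum>i. a i z)" for z
  have unif: "uniform_limit (cball 0 R) (\<lambda>n z. \<Sum>i<n. a i z) h sequentially"
    and summ: "\<And>z. norm z \<le> R \<Longrightarrow> summable (\<lambda>i. a i z)" for R
  proof -
    have "\<forall>\<^sub>F N in sequentially. (\<gamma> ^^ N) ` cball 0 R \<subseteq> U" by (intro \<gamma>_contr U U0 compact_cball)
    then obtain N where N: "(\<gamma> ^^ N) ` cball 0 R \<subseteq> U"
      unfolding eventually_sequentially by blast
    \<comment> \<open>The bound for the tail of the series on the small box, shifted by the \<open>N\<close> steps
      that \<open>\<gamma>\<close> needs to bring the ball into it.\<close>
    define M where "M i = (C * (\<epsilon> / 2) ^ s / cmod \<mu> / cmod \<mu> ^ N / q ^ N) * q ^ i" for i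
    have M: "cmod (a i z) \<le> M i" if i: "i \<ge> N" and z: "z \<in> cball 0 R" for i z
    proof -
      obtain k where k: "i = k + N" using i by (metis add.commute le_add_diff_inverse)
      have "(\<gamma> ^^ N) z \<in> weighted_box wt (\<epsilon> / 2)" using N z Ubox by blast
      then have "cmod (a k ((\<gamma> ^^ N) z)) \<le> (C * (\<epsilon> / 2) ^ s / cmod \<mu>) * q ^ k"
        using \<epsilon> by (intro a_bound) auto
      then have "cmod (a i z) \<le> (C * (\<epsilon> / 2) ^ s / cmod \<mu>) * q ^ k / cmod \<mu> ^ N"
        unfolding k a_shift norm_divide norm_power by (intro divide_right_mono) auto
      also have "\<dots> = M i" using q by (simp add: M_def k power_add)
      finally show ?thesis .
    qed
    have ev: "\<forall>\<^sub>F i in sequentially. \<forall>z\<in>cball 0 R. norm (a i z) \<le> M i"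
      using M by (auto intro!: eventually_sequentiallyI[of N])
    have sM: "summable M" unfolding M_def using q by (intro summable_mult summable_geometric) auto
    show "uniform_limit (cball 0 R) (\<lambda>n z. \<Sum>i<n. a i z) h sequentially"
      unfolding h_def by (rule Weierstrass_m_test_ev[OF ev sM])
    show "summable (\<lambda>i. a i z)" if "norm z \<le> R" for z
      by (rule summable_comparison_test_ev[OF _ sM]) (use ev that in \<open>auto elim!: eventually_mono\<close>)
  qed
  have "entire h"
  proof (rule entire_approx)
    fix R e :: real assume "0 < e"
    from uniform_limitD[OF unif this, of R]
    obtain n where "\<forall>z\<in>cball 0 R. dist (\<Sum>i<n. a i z) (h z) < e"
      unfolding eventually_sequentially by blast
    moreover have "entire (\<lambda>z. \<Sum>i<n. a i z)"
    proof (rule entire_sum)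
      fix i
      have "entire (\<lambda>z. g ((\<gamma> ^^ i) z) * (- inverse (\<mu> ^ Suc i)))"
        by (intro entire_mult entire_const entire_compose[OF g(1)] entire_iterate)
      then show "entire (a i)" unfolding a_def divide_inverse by simp
    qed
    ultimately show "\<exists>f. entire f \<and> (\<forall>z\<in>cball 0 R. cmod (f z - h z) \<le> e)"
      by (intro exI[of _ "\<lambda>z. \<Sum>i<n. a i z"]) (auto simp: dist_norm intro: less_imp_le)
  qed
  moreover have "vanishes wt s h"
    unfolding vanishes_def
  proof (intro exI eventually_at_rightI[of 0 \<epsilon>] ballI)
    fix t z assume t: "t \<in> {0<..<\<epsilon>}" and z: "z \<in> weighted_box wt t"
    have "(\<lambda>i. a i z) sums h z" unfolding h_def using summ[of z "norm z"] by (simp add: summable_sums)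
    moreover have "(\<lambda>i. (C * t ^ s / cmod \<mu>) * q ^ i) sums ((C * t ^ s / cmod \<mu>) * (1 / (1 - q)))"
      using q by (intro sums_mult geometric_sums) auto
    ultimately have "cmod (h z) \<le> (C * t ^ s / cmod \<mu>) * (1 / (1 - q))"
      by (rule norm_sums_le) (use a_bound t z in auto)
    then show "cmod (h z) \<le> (C / cmod \<mu> * (1 / (1 - q))) * t ^ s" by (simp add: mult_ac)
  qed (use \<epsilon> in simp)
  moreover have "g z = h (\<gamma> z) - \<mu> * h z" for z
  proof -
    have "(\<lambda>i. a (Suc i) z) sums (h z - a 0 z)"
      unfolding h_def using summ[of z "norm z"] by (intro sums_Suc_iff[THEN iffD2]) (simp add: summable_sums)
    then have "(\<lambda>i. \<mu> * a (Suc i) z) sums (\<mu> * (h z - a 0 z))" by (rule sums_mult)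
    moreover have "\<mu> * a (Suc i) z = a i (\<gamma> z)" for i
      using a_shift[of i 1 z] lam1 by simp
    ultimately have "(\<lambda>i. a i (\<gamma> z)) sums (\<mu> * (h z - a 0 z))" by simp
    from sums_unique[OF this] have "h (\<gamma> z) = \<mu> * (h z - a 0 z)" by (simp only: h_def)
    then show ?thesis using lam1 by (simp add: a_def algebra_simps)
  qed
  ultimately show ?thesis by (rule that)
qed

lemma mono_pow_scale: "mono_pow (\<chi> l. \<beta> $ l * z $ l) p = mono_pow \<beta> p * mono_pow z p"
  by (simp add: mono_pow_def power_mult_distrib prod.distrib)

text \<open>
  One weight is treated at a time. Modulo heavier terms, \<open>z\<^sup>p \<circ> \<gamma> - \<mu> z\<^sup>p\<close> is \<open>(\<beta>\<^sup>p - \<mu>) z\<^sup>p\<close> and \<open>\<Psi>\<^sup>p\<close> is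
  \<open>z\<^sup>p\<close>, so a leading monomial with \<open>\<beta>\<^sup>p \<noteq> \<mu>\<close> is absorbed in \<open>h\<close> and one with \<open>\<beta>\<^sup>p = \<mu>\<close> in the sum of
  the \<open>\<Psi>\<^sup>p\<close>.
\<close>

lemma eliminate_weights:
  assumes \<Psi>: "\<And>l. entire (\<lambda>z. \<Psi> z $ l)" "\<And>l. vanishes wt (wt l + 1) (\<lambda>z. \<Psi> z $ l - z $ l)"
    and g: "entire g" "vanishes wt s g"
  shows "\<exists>h c. entire h \<and> vanishes wt s h \<and> vanishes wt (s + m) (\<lambda>z. g z - (h (\<gamma> z) - \<mu> * h z)
      - (\<Sum>p | s \<le> weight wt p \<and> weight wt p < s + m \<and> mono_pow \<beta> p = \<mu>. c p * mono_pow (\<Psi> z) p))"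
proof (induction m)
  case 0
  show ?case using g by (intro exI[of _ "\<lambda>z. 0"] exI[of _ "\<lambda>p. 0"]) auto
next
  case (Suc m)
  let ?A = "\<lambda>m. {p. s \<le> weight wt p \<and> weight wt p < s + m \<and> mono_pow \<beta> p = \<mu>}"
  let ?W = "{p. weight wt p = s + m}"
  obtain h c where h: "entire h" "vanishes wt s h" and
    v: "vanishes wt (s + m) (\<lambda>z. g z - (h (\<gamma> z) - \<mu> * h z) - (\<Sum>p\<in>?A m. c p * mono_pow (\<Psi> z) p))"
    using Suc by blast
  have mono_ent: "entire (\<lambda>z. mono_pow (\<Psi> z) p)" for p
    by (rule entire_compose[OF entire_mono_pow \<Psi>(1)])
  have "entire (\<lambda>z. g z - (h (\<gamma> z) - \<mu> * h z) - (\<Sum>p\<in>?A m. c p * mono_pow (\<Psi> z) p))"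
    by (intro entire_diff entire_sum entire_mult entire_const g h entire_comp_\<gamma> mono_ent)
  from weighted_taylor[of wt, OF wt_pos this v] obtain a where
    a: "vanishes wt (s + m + 1) (\<lambda>z. g z - (h (\<gamma> z) - \<mu> * h z) - (\<Sum>p\<in>?A m. c p * mono_pow (\<Psi> z) p)
        - (\<Sum>p\<in>?W. a p * mono_pow z p))" by blast
  have finW: "finite ?W" by (rule finite_weight_eq) (rule wt_pos)
  let ?R = "{p\<in>?W. mono_pow \<beta> p = \<mu>}" and ?N = "{p\<in>?W. mono_pow \<beta> p \<noteq> \<mu>}"
  define b where "b p = a p / (mono_pow \<beta> p - \<mu>)" for p
  define h' where "h' z = h z + (\<Sum>p\<in>?N. b p * mono_pow z p)" for z
  define c' where "c' p = (if p \<in> ?R then a p else c p)" for p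
  have "vanishes wt (weight wt p + 1) (\<lambda>z. mono_pow (\<Psi> z) p - mono_pow z p)" for p
  proof (rule vanishes_mono_pow_diff)
    show "vanishes wt (wt l) (\<lambda>z. \<Psi> z $ l)" for l
      using vanishes_add[OF vanishes_mono[OF \<Psi>(2)[of l], of "wt l"] vanishes_coord[of wt l]] by simp
  qed (rule vanishes_coord \<Psi>)+
  then have 1: "vanishes wt (s + m + 1) (\<lambda>z. \<Sum>p\<in>?R. a p * (mono_pow (\<Psi> z) p - mono_pow z p))"
    by (intro vanishes_sum vanishes_cmult) (auto, metis)
  have "vanishes wt (weight wt p + 1) (\<lambda>z. mono_pow (\<gamma> z) p - mono_pow (\<chi> l. \<beta> $ l * z $ l) p)" for p
    by (rule vanishes_mono_pow_diff) (auto intro!: \<gamma>_vanishes vanishes_cmult vanishes_coord \<gamma>_leading[simplified])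
  then have 2: "vanishes wt (s + m + 1) (\<lambda>z. \<Sum>p\<in>?N. b p * (mono_pow (\<gamma> z) p - mono_pow \<beta> p * mono_pow z p))"
    unfolding mono_pow_scale by (intro vanishes_sum vanishes_cmult) (auto, metis)
  have eq: "g z - (h' (\<gamma> z) - \<mu> * h' z) - (\<Sum>p\<in>?A (Suc m). c' p * mono_pow (\<Psi> z) p)
     = (g z - (h (\<gamma> z) - \<mu> * h z) - (\<Sum>p\<in>?A m. c p * mono_pow (\<Psi> z) p) - (\<Sum>p\<in>?W. a p * mono_pow z p))
       - (\<Sum>p\<in>?R. a p * (mono_pow (\<Psi> z) p - mono_pow z p))
       - (\<Sum>p\<in>?N. b p * (mono_pow (\<gamma> z) p - mono_pow \<beta> p * mono_pow z p))" for z
  proof -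
    have A: "?A (Suc m) = ?A m \<union> ?R" "?A m \<inter> ?R = {}" by auto
    have "finite (\<Union>k\<in>{..<s + m}. {p :: 'n multi_index. weight wt p = k})"
      by (intro finite_UN_I finite_weight_eq wt_pos) auto
    then have finA: "finite (?A m)" by (rule rev_finite_subset) auto
    have "(\<Sum>p\<in>?A (Suc m). c' p * mono_pow (\<Psi> z) p)
        = (\<Sum>p\<in>?A m. c' p * mono_pow (\<Psi> z) p) + (\<Sum>p\<in>?R. c' p * mono_pow (\<Psi> z) p)"
      unfolding A(1) by (rule sum.union_disjoint) (use finA finW A(2) in auto)
    also have "(\<Sum>p\<in>?A m. c' p * mono_pow (\<Psi> z) p) = (\<Sum>p\<in>?A m. c p * mono_pow (\<Psi> z) p)"
      by (intro sum.cong) (auto simp: c'_def)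
    also have "(\<Sum>p\<in>?R. c' p * mono_pow (\<Psi> z) p) = (\<Sum>p\<in>?R. a p * mono_pow (\<Psi> z) p)"
      by (intro sum.cong) (auto simp: c'_def)
    finally have S1: "(\<Sum>p\<in>?A (Suc m). c' p * mono_pow (\<Psi> z) p)
       = (\<Sum>p\<in>?A m. c p * mono_pow (\<Psi> z) p) + (\<Sum>p\<in>?R. a p * mono_pow (\<Psi> z) p)" .
    have "?W = ?R \<union> ?N" "?R \<inter> ?N = {}" by auto
    then have S2: "(\<Sum>p\<in>?W. a p * mono_pow z p) = (\<Sum>p\<in>?R. a p * mono_pow z p) + (\<Sum>p\<in>?N. a p * mono_pow z p)"
      using finW by (metis (no_types, lifting) finite_Un sum.union_disjoint)
    have S3: "(\<Sum>p\<in>?N. a p * mono_pow z p) = (\<Sum>p\<in>?N. b p * (mono_pow \<beta> p * mono_pow z p)) - \<mu> * (\<Sum>p\<in>?N. b p * mono_pow z p)"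
      unfolding sum_distrib_left sum_subtractf[symmetric]
    proof (rule sum.cong)
      fix p assume "p \<in> ?N"
      then have "a p = b p * (mono_pow \<beta> p - \<mu>)" by (simp add: b_def)
      then show "a p * mono_pow z p = b p * (mono_pow \<beta> p * mono_pow z p) - \<mu> * (b p * mono_pow z p)"
        by (simp only: left_diff_distrib right_diff_distrib mult_ac)
    qed simp
    show ?thesis unfolding S1 S2 S3 h'_def
      by (simp add: sum_subtractf right_diff_distrib distrib_left)
  qed
  have "entire h'" unfolding h'_def by (intro entire_add entire_sum entire_mult entire_const h entire_mono_pow)
  moreover have "vanishes wt s h'" unfolding h'_def
  proof (intro vanishes_add vanishes_sum vanishes_cmult h)
    fix p assume "p \<in> ?N"
    then have p: "weight wt p = s + m" by simp
    have "vanishes wt (weight wt p) (\<lambda>z. mono_pow z p)"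
      unfolding weight_def mono_pow_def by (intro vanishes_prod vanishes_power vanishes_coord)
    then show "vanishes wt s (\<lambda>z. mono_pow z p)" using p vanishes_mono by force
  qed
  moreover have "vanishes wt (s + Suc m) (\<lambda>z. g z - (h' (\<gamma> z) - \<mu> * h' z) - (\<Sum>p\<in>?A (Suc m). c' p * mono_pow (\<Psi> z) p))"
    unfolding eq using vanishes_diff[OF vanishes_diff[OF a 1] 2] by simp
  ultimately show ?case by blast
qed

lemma resonant_decomposition:
  assumes \<Psi>: "\<And>l. entire (\<lambda>z. \<Psi> z $ l)" "\<And>l. vanishes wt (wt l + 1) (\<lambda>z. \<Psi> z $ l - z $ l)"
    and g: "entire g" "vanishes wt s g" and lam: "\<mu> \<noteq> 0"
  shows "\<exists>h c A. entire h \<and> vanishes wt s h \<and> finite A \<and>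
    (\<forall>p\<in>A. s \<le> weight wt p \<and> mono_pow \<beta> p = \<mu>) \<and>
    (\<forall>z. g z = h (\<gamma> z) - \<mu> * h z + (\<Sum>p\<in>A. c p * mono_pow (\<Psi> z) p))"
proof -
  obtain \<theta> where \<theta>: "0 < \<theta>" "\<theta> < 1"
    and box: "\<forall>\<^sub>F t in at_right 0. \<forall>z\<in>weighted_box wt t. \<gamma> z \<in> weighted_box wt (\<theta> * t)"
    by (rule contraction_of_boxes)
  obtain m where m: "\<theta> ^ m < cmod \<mu>" using real_arch_pow_inv[of "cmod \<mu>" \<theta>] lam \<theta> by auto
  have "\<theta> ^ (s + m) \<le> \<theta> ^ m" using \<theta> by (intro power_decreasing) auto
  with m have lt: "\<theta> ^ (s + m) < cmod \<mu>" by linarith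
  let ?A = "{p. s \<le> weight wt p \<and> weight wt p < s + m \<and> mono_pow \<beta> p = \<mu>}"
  have "finite (\<Union>k\<in>{..<s + m}. {p :: 'n multi_index. weight wt p = k})"
    by (intro finite_UN_I finite_weight_eq wt_pos) auto
  then have finA: "finite ?A" by (rule rev_finite_subset) auto
  obtain h c where h: "entire h" "vanishes wt s h" and
    v: "vanishes wt (s + m) (\<lambda>z. g z - (h (\<gamma> z) - \<mu> * h z) - (\<Sum>p\<in>?A. c p * mono_pow (\<Psi> z) p))"
    using eliminate_weights[OF \<Psi> g, of m \<mu>] by blast
  have "entire (\<lambda>z. g z - (h (\<gamma> z) - \<mu> * h z) - (\<Sum>p\<in>?A. c p * mono_pow (\<Psi> z) p))"
    by (intro entire_diff entire_sum entire_mult entire_const g h entire_comp_\<gamma>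
        entire_compose[OF entire_mono_pow \<Psi>(1)])
  from solve_cohomological[OF box \<theta> this v lt] obtain k where k: "entire k" "vanishes wt (s + m) k"
    and keq: "\<And>z. g z - (h (\<gamma> z) - \<mu> * h z) - (\<Sum>p\<in>?A. c p * mono_pow (\<Psi> z) p) = k (\<gamma> z) - \<mu> * k z"
    by blast
  have "entire (\<lambda>z. h z + k z)" by (intro entire_add h k)
  moreover have "vanishes wt s (\<lambda>z. h z + k z)" by (intro vanishes_add h vanishes_mono[OF k(2)]) simp
  moreover have "g z = h (\<gamma> z) + k (\<gamma> z) - \<mu> * (h z + k z) + (\<Sum>p\<in>?A. c p * mono_pow (\<Psi> z) p)" for z
    using keq[of z] by (simp add: algebra_simps)
  ultimately show ?thesis
    using finA by (intro exI[of _ "\<lambda>z. h z + k z"] exI[of _ c] exI[of _ ?A]) auto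
qed

lemma weight_axis: "weight wt (axis k 1) = wt k"
  using weight_add_axis[of wt 0 k] by (simp add: weight_def)

lemma finite_sub_resonances: "finite (sub_resonances \<beta> j)"
proof -
  have "mi_length q = weight (\<lambda>_. 1) q" for q :: "'n multi_index" by (simp add: mi_length_def weight_def)
  then have "sub_resonances \<beta> j \<subseteq> (\<Union>k\<in>{..max_resonance_length \<beta>}. {p. weight (\<lambda>_. 1) p = k})"
    using sub_resonance_length_le[OF \<beta>_pos \<beta>_less] by fastforce
  then show ?thesis by (rule finite_subset) (intro finite_UN_I finite_weight_eq; simp)
qed

text \<open>
  The weight excludes the unit multi-indices \<open>axis k 1\<close> with \<open>k \<ge> j\<close>, which are no heavier than \<open>z\<^sub>j\<close>.
\<close>

lemma heavy_resonance:
  assumes "wt j + 1 \<le> weight wt p" "mono_pow \<beta> p = \<beta> $ j"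
  shows "p \<in> sub_resonances \<beta> j"
proof -
  have "p \<noteq> axis k 1" if "k \<ge> j" for k
    using assms(1) wt_antimono[OF that] weight_axis[of k] by auto
  moreover have "p \<noteq> 0" using assms(1) by (auto simp: weight_def)
  ultimately show ?thesis using assms(2) unfolding sub_resonances_def resonances_def by (intro CollectI conjI bexI[of _ p]) auto
qed

text \<open>
  Triangularity of the normal form: a subresonant monomial for the index \<open>j\<close> sees only earlier
  variables.
\<close>

lemma mono_pow_cong:
  assumes "q \<in> sub_resonances \<beta> j" "\<And>l. l < j \<Longrightarrow> x $ l = y $ l"
  shows "mono_pow x q = mono_pow y q"
proof -
  have "x $ l ^ q $ l = y $ l ^ q $ l" for l
    using sub_resonance_triangular[OF \<beta>_pos \<beta>_less \<beta>_ord assms(1), of l] assms(2)[of l]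
    by (cases "l < j") auto
  then show ?thesis by (simp add: mono_pow_def)
qed

text \<open>
  The components are constructed in the order of their indices, as \<open>\<Psi>\<^sub>j = z\<^sub>j - h\<close> where \<open>h\<close> absorbs
  the nonresonant part of \<open>\<gamma>\<^sub>j - \<beta>\<^sub>j z\<^sub>j\<close>. The resonant monomials left over contain only the earlier
  components, so replacing the \<open>j\<close>-th one spoils no equation.
\<close>

theorem semiconjugacy:
  obtains \<Psi> c where "\<And>l. entire (\<lambda>z. \<Psi> z $ l)" "\<And>l. vanishes wt (wt l + 1) (\<lambda>z. \<Psi> z $ l - z $ l)"
    "\<And>l z. \<Psi> (\<gamma> z) $ l = \<beta> $ l * \<Psi> z $ l + (\<Sum>q\<in>sub_resonances \<beta> l. c l q * mono_pow (\<Psi> z) q)"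
proof -
  have "\<exists>\<Psi> c. (\<forall>l. entire (\<lambda>z. \<Psi> z $ l)) \<and> (\<forall>l. vanishes wt (wt l + 1) (\<lambda>z. \<Psi> z $ l - z $ l)) \<and>
    (\<forall>l\<in>S. \<forall>z. \<Psi> (\<gamma> z) $ l = \<beta> $ l * \<Psi> z $ l + (\<Sum>q\<in>sub_resonances \<beta> l. c l q * mono_pow (\<Psi> z) q))"
    if "finite S" for S :: "'n set"
    using that
  proof (induction S rule: finite_linorder_max_induct)
    case empty
    show ?case by (intro exI[of _ "\<lambda>z. z"]) auto
  next
    case (insert j S)
    then obtain \<Psi> c where \<Psi>: "\<And>l. entire (\<lambda>z. \<Psi> z $ l)" "\<And>l. vanishes wt (wt l + 1) (\<lambda>z. \<Psi> z $ l - z $ l)"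
      and eq: "\<And>l z. l \<in> S \<Longrightarrow> \<Psi> (\<gamma> z) $ l = \<beta> $ l * \<Psi> z $ l + (\<Sum>q\<in>sub_resonances \<beta> l. c l q * mono_pow (\<Psi> z) q)"
      by blast
    have ent: "entire (\<lambda>z. \<gamma> z $ j - \<beta> $ j * z $ j)" by (intro entire_diff entire_mult entire_const entire_coord \<gamma>_entire)
    have nz: "\<beta> $ j \<noteq> 0" using \<beta>_pos[of j] by auto
    obtain h d A where h: "entire h" "vanishes wt (wt j + 1) h" and A: "finite A"
      "\<forall>p\<in>A. wt j + 1 \<le> weight wt p \<and> mono_pow \<beta> p = \<beta> $ j"
      and heq: "\<forall>z. \<gamma> z $ j - \<beta> $ j * z $ j = h (\<gamma> z) - \<beta> $ j * h z + (\<Sum>p\<in>A. d p * mono_pow (\<Psi> z) p)"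
      using resonant_decomposition[OF \<Psi> ent \<gamma>_leading nz] by (elim exE conjE) (rule that)
    have AQ: "A \<subseteq> sub_resonances \<beta> j" using A(2) heavy_resonance by blast
    define \<Phi> where "\<Phi> z = (\<chi> l. if l = j then z $ j - h z else \<Psi> z $ l)" for z
    define e where "e l q = (if l = j then if q \<in> A then d q else 0 else c l q)" for l q
    have agree: "mono_pow (\<Phi> z) q = mono_pow (\<Psi> z) q" if "q \<in> sub_resonances \<beta> l" "l \<le> j" for z q l
      by (rule mono_pow_cong[OF that(1)]) (use that(2) in \<open>auto simp: \<Phi>_def\<close>)
    have "entire (\<lambda>z. \<Phi> z $ l)" for l
      using \<Psi>(1) by (cases "l = j") (auto simp: \<Phi>_def intro!: entire_diff h)
    moreover have "vanishes wt (wt l + 1) (\<lambda>z. \<Phi> z $ l - z $ l)" for l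
      using \<Psi>(2)[of l] vanishes_cmult[OF h(2), of "-1"] by (cases "l = j") (auto simp: \<Phi>_def)
    moreover have "\<Phi> (\<gamma> z) $ l = \<beta> $ l * \<Phi> z $ l + (\<Sum>q\<in>sub_resonances \<beta> l. e l q * mono_pow (\<Phi> z) q)"
      if l: "l \<in> insert j S" for l z
    proof (cases "l = j")
      case True
      have "(\<Sum>q\<in>sub_resonances \<beta> j. e j q * mono_pow (\<Phi> z) q) = (\<Sum>q\<in>A. d q * mono_pow (\<Psi> z) q)"
      proof (rule sum.mono_neutral_cong_right[OF finite_sub_resonances AQ])
        show "e j q * mono_pow (\<Phi> z) q = d q * mono_pow (\<Psi> z) q" if "q \<in> A" for q
          using that agree[of q j z] AQ by (simp add: e_def subset_iff)
      qed (simp add: e_def)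
      moreover have "\<gamma> z $ j - h (\<gamma> z) = \<beta> $ j * (z $ j - h z) + (\<Sum>p\<in>A. d p * mono_pow (\<Psi> z) p)"
        using heq[rule_format, of z] by (simp add: right_diff_distrib) (simp add: add_ac diff_eq_eq eq_diff_eq)
      ultimately show ?thesis using True by (simp add: \<Phi>_def)
    next
      case False
      then have lS: "l \<in> S" and lj: "l \<le> j" using l insert.hyps by (auto intro: less_imp_le)
      have "(\<Sum>q\<in>sub_resonances \<beta> l. e l q * mono_pow (\<Phi> z) q) = (\<Sum>q\<in>sub_resonances \<beta> l. c l q * mono_pow (\<Psi> z) q)"
        using False by (intro sum.cong refl) (simp add: e_def agree[OF _ lj])
      then show ?thesis using eq[OF lS, of z] False by (simp add: \<Phi>_def)
    qed
    ultimately show ?case by blast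
  qed
  from this[of UNIV] show ?thesis using that by auto
qed

end

section \<open>The coordinates form a biholomorphism\<close>

definition total_differential :: "(complex^'n \<Rightarrow> complex^'m) \<Rightarrow> complex^'n \<Rightarrow> complex^'n \<Rightarrow> complex^'m" where
  "total_differential F z v = (\<chi> l. differential (\<lambda>z. F z $ l) z v)"

lemma total_differential:
  assumes "\<And>l. entire (\<lambda>z. F z $ l)"
  shows "(F has_derivative total_differential F z) (at z)"
    and "total_differential F z (c *s v) = c *s total_differential F z v"
  using assms by (auto intro!: has_derivative_vecI simp: total_differential_def entire_differential vec_eq_iff)

lemma total_differential_unique:
  assumes "\<And>l. entire (\<lambda>z. F z $ l)" "(F has_derivative D) (at z)"
  shows "total_differential F z = D"
  using has_derivative_unique[OF total_differential(1)[OF assms(1)] assms(2)] by blast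

lemma total_differential_0:
  assumes "\<And>l. entire (\<lambda>z. F z $ l)"
  shows "total_differential F z 0 = 0"
  using total_differential(2)[OF assms, of z 0 0] by simp

lemma total_differential_compose:
  assumes F: "\<And>l. entire (\<lambda>z. F z $ l)" and G: "\<And>l. entire (\<lambda>z. G z $ l)"
  shows "total_differential (\<lambda>z. F (G z)) z v = total_differential F (G z) (total_differential G z v)"
proof -
  have "entire (\<lambda>z. F (G z) $ l)" for l by (rule entire_compose[OF F G])
  from total_differential_unique[OF this has_derivative_compose[OF total_differential(1)[OF G] total_differential(1)[OF F]]]
  show ?thesis by simp
qed

lemma holomorphic_map_iff_entire: "holomorphic_map F \<longleftrightarrow> (\<forall>l. entire (\<lambda>z. F z $ l))"
proof
  assume F: "holomorphic_map F"
  show "\<forall>l. entire (\<lambda>z. F z $ l)"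
    unfolding entire_def
  proof (intro allI)
    fix l z
    obtain f' where f': "Vector_Spaces.linear (*s) (*s) f'" "(F has_derivative f') (at z)"
      using F unfolding holomorphic_map_def by blast
    have "f' (c *s v) = c *s f' v" for c v using f'(1) by (simp add: Vector_Spaces.linear_iff)
    then show "\<exists>f'. (\<forall>c v. f' (c *s v) = c * f' v) \<and> ((\<lambda>z. F z $ l) has_derivative f') (at z)"
      by (intro exI[of _ "\<lambda>v. f' v $ l"] conjI bounded_linear.has_derivative[OF bounded_linear_vec_nth f'(2)]) auto
  qed
next
  assume F: "\<forall>l. entire (\<lambda>z. F z $ l)"
  show "holomorphic_map F"
    unfolding holomorphic_map_def
  proof (intro allI exI conjI)
    fix z
    have d: "(F has_derivative total_differential F z) (at z)" by (rule total_differential) (use F in auto)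
    then show "(F has_derivative total_differential F z) (at z)" .
    have "linear (total_differential F z)" by (rule has_derivative_linear[OF d])
    then show "Vector_Spaces.linear (*s) (*s) (total_differential F z)"
      unfolding Vector_Spaces.linear_iff
      using total_differential(2)[of F] F by (auto simp: linear_add intro: vec.vector_space_axioms)
  qed
qed

text \<open>
  Uniform continuity of \<open>f\<close> on a ball and Cauchy's inequality for \<open>f(\<cdot> + x) - f\<close> give continuity of the
  differential, which the inverse function theorem asks for.
\<close>

lemma differential_continuous:
  fixes f :: "complex^'n \<Rightarrow> complex"
  assumes f: "entire f" and e: "e > 0"
  shows "\<exists>d>0. \<forall>x. norm x < d \<longrightarrow> (\<forall>v. cmod (differential f x v - differential f 0 v) \<le> e * norm v)"
proof -
  have uc: "uniformly_continuous_on (cball 0 2) f"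
    by (intro compact_uniformly_continuous entire_continuous_on f) auto
  obtain d where d0: "d > 0"
    and d': "\<And>x y. x \<in> cball 0 2 \<Longrightarrow> y \<in> cball 0 2 \<Longrightarrow> dist y x < d \<Longrightarrow> dist (f y) (f x) < e"
    by (rule uniformly_continuous_onE[OF uc e]) (rule that)
  have d: "\<And>x y. norm x \<le> 2 \<Longrightarrow> norm y \<le> 2 \<Longrightarrow> dist y x < d \<Longrightarrow> dist (f y) (f x) < e"
    using d' by simp
  have "cmod (differential f x v - differential f 0 v) \<le> e * norm v" if x: "norm x < min d 1" for x v
  proof -
    have g: "entire (\<lambda>z. f (z + x))" by (rule entire_compose[OF f]) auto
    have sh: "((\<lambda>z. z + x) has_derivative (\<lambda>v. v)) (at 0)" by (auto intro!: derivative_eq_intros)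
    have "((\<lambda>z. f (z + x)) has_derivative (\<lambda>v. differential f (0 + x) v)) (at 0)"
      by (rule has_derivative_compose[OF sh entire_differential(1)[OF f]])
    then have eq: "differential (\<lambda>z. f (z + x)) 0 = differential f x"
      using frechet_derivative_at[of "\<lambda>z. f (z + x)" _ 0] by (metis add_0)
    have "cmod (differential (\<lambda>z. f (z + x)) 0 v - differential f 0 v) \<le> e * norm v"
    proof (rule differential_bound_diff[OF g f])
      fix u :: "complex^'n" assume u: "norm (u - 0) \<le> 1"
      have "norm (u + x) \<le> 2" using u x norm_triangle_ineq[of u x] by simp
      then have "dist (f (u + x)) (f u) < e" using u x by (intro d) (auto simp: dist_norm)
      then show "cmod (f (u + x) - f u) \<le> e" by (simp add: dist_norm)
    qed
    then show ?thesis unfolding eq .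
  qed
  then show ?thesis using d0 by (intro exI[of _ "min d 1"]) auto
qed

lemma total_differential_continuous:
  fixes F :: "complex^'n \<Rightarrow> complex^'m"
  assumes F: "\<And>l. entire (\<lambda>z. F z $ l)" and e: "e > 0"
  shows "\<exists>d>0. \<forall>x. norm x < d \<longrightarrow>
    (\<forall>v. norm (total_differential F x v - total_differential F 0 v) \<le> e * norm v)"
proof -
  let ?e = "e / CARD('m)"
  have "\<forall>l. \<exists>d>0. \<forall>x. norm x < d \<longrightarrow>
      (\<forall>v. cmod (differential (\<lambda>z. F z $ l) x v - differential (\<lambda>z. F z $ l) 0 v) \<le> ?e * norm v)"
    by (intro allI differential_continuous[OF F]) (use e in simp)
  from choice[OF this] obtain d where d: "\<And>l. d l > 0" and
    db: "\<And>l x v. norm x < d l \<Longrightarrow>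
      cmod (differential (\<lambda>z. F z $ l) x v - differential (\<lambda>z. F z $ l) 0 v) \<le> ?e * norm v"
    by blast
  have "norm (total_differential F x v - total_differential F 0 v) \<le> e * norm v"
    if x: "norm x < Min (range d)" for x v
  proof -
    have xd: "norm x < d l" for l using x by simp
    have "norm (total_differential F x v - total_differential F 0 v)
        \<le> (\<Sum>l\<in>UNIV. cmod ((total_differential F x v - total_differential F 0 v) $ l))"
      unfolding norm_vec_def by (rule L2_set_le_sum) auto
    also have "\<dots> \<le> (\<Sum>l\<in>(UNIV::'m set). ?e * norm v)"
      unfolding vector_minus_component total_differential_def vec_lambda_beta by (intro sum_mono db xd)
    also have "\<dots> = e * norm v" by simp
    finally show ?thesis .
  qed
  moreover have "Min (range d) > 0" using d by simp
  ultimately show ?thesis by blast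
qed

lemma linear_recursion_tendsto_0:
  fixes u e :: "nat \<Rightarrow> complex"
  assumes rec: "\<And>n. u (Suc n) = b * u n + e n" and e: "e \<longlonglongrightarrow> 0" and b: "cmod b < 1"
  shows "u \<longlonglongrightarrow> 0"
proof (rule LIMSEQ_I)
  fix r :: real assume r: "r > 0"
  define s where "s = (1 - cmod b) * (r / 2)"
  have "s > 0" using b r by (simp add: s_def)
  then obtain M where M: "\<And>n. n \<ge> M \<Longrightarrow> cmod (e n) < s" using LIMSEQ_D[OF e, of s] by auto
  have bd: "cmod (u (M + k)) \<le> cmod b ^ k * cmod (u M) + r / 2" for k
  proof (induction k)
    case (Suc k)
    have "cmod (u (M + Suc k)) \<le> cmod b * cmod (u (M + k)) + cmod (e (M + k))"
      using norm_triangle_ineq[of "b * u (M + k)" "e (M + k)"] by (simp add: rec norm_mult)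
    also have "\<dots> \<le> cmod b * (cmod b ^ k * cmod (u M) + r / 2) + s"
      using Suc M[of "M + k"] by (intro add_mono mult_left_mono) auto
    also have "\<dots> = cmod b ^ Suc k * cmod (u M) + r / 2" by (simp add: s_def field_simps)
    finally show ?case .
  qed (use r in simp)
  have "(\<lambda>k. cmod b ^ k * cmod (u M)) \<longlonglongrightarrow> 0 * cmod (u M)"
    using b by (intro tendsto_intros LIMSEQ_realpow_zero) auto
  from LIMSEQ_D[OF this, of "r / 2"] obtain K where K: "\<And>k. k \<ge> K \<Longrightarrow> \<bar>cmod b ^ k * cmod (u M)\<bar> < r / 2"
    using r by auto
  show "\<exists>no. \<forall>n\<ge>no. cmod (u n - 0) < r"
  proof (intro exI[of _ "M + K"] allI impI)
    fix n assume n: "n \<ge> M + K"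
    then have "M + (n - M) = n" "n - M \<ge> K" by auto
    then show "cmod (u n - 0) < r" using bd[of "n - M"] K[of "n - M"] by auto
  qed
qed

text \<open>
  Induction along a finite linear order, which need not be an instance of the class of well-orders.
\<close>

lemma less_card_induct [case_names less]:
  fixes l :: "'n::{finite,linorder}"
  assumes "\<And>l. (\<And>i. i < l \<Longrightarrow> Q i) \<Longrightarrow> Q l"
  shows "Q l"
proof (induction "card {i. i < l}" arbitrary: l rule: less_induct)
  case less
  show ?case
  proof (rule assms)
    fix i assume "i < l"
    then have "{k. k < i} \<subset> {k. k < l}" by auto
    from psubset_card_mono[OF _ this] show "Q i" by (intro less) simp
  qed
qed

lemma funpow_commute: "(\<And>z. f (g z) = h (f z)) \<Longrightarrow> f ((g ^^ N) z) = (h ^^ N) (f z)"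
  by (induction N) auto

lemma entire_funpow:
  fixes F :: "complex^'k \<Rightarrow> complex^'k"
  assumes "\<And>l. entire (\<lambda>z. F z $ l)"
  shows "entire (\<lambda>z. (F ^^ N) z $ l)"
proof (induction N arbitrary: l)
  case (Suc N)
  then show ?case using entire_compose[OF assms, of "F ^^ N" l] by simp
qed auto

context triangular_contraction
begin

context
  fixes c :: "'n \<Rightarrow> 'n multi_index \<Rightarrow> complex"
begin

definition normal_form :: "'n cvec \<Rightarrow> 'n cvec" where
  "normal_form y = (\<chi> l. \<beta> $ l * y $ l + (\<Sum>q\<in>sub_resonances \<beta> l. c l q * mono_pow y q))"

lemma inj_normal_form: "inj normal_form"
proof (rule injI)
  fix x y assume xy: "normal_form x = normal_form y"
  have "x $ l = y $ l" for l
  proof (induction l rule: less_card_induct)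
    case (less l)
    have "(\<Sum>q\<in>sub_resonances \<beta> l. c l q * mono_pow x q) = (\<Sum>q\<in>sub_resonances \<beta> l. c l q * mono_pow y q)"
      using mono_pow_cong[of _ l x y] less by (intro sum.cong) auto
    then have "\<beta> $ l * x $ l = \<beta> $ l * y $ l" using arg_cong[OF xy, of "\<lambda>z. z $ l"] by (simp add: normal_form_def)
    then show ?case using \<beta>_pos[of l] by auto
  qed
  then show "x = y" by (simp add: vec_eq_iff)
qed

lemma normal_form_entire: "entire (\<lambda>y. normal_form y $ l)"
  unfolding normal_form_def vec_lambda_beta
  by (intro entire_add entire_sum entire_mult entire_const entire_coord entire_mono_pow)

text \<open>
  Coordinate by coordinate: once the earlier coordinates tend to \<open>0\<close>, the \<open>l\<close>-th one satisfies a
  linear recursion with factor \<open>\<beta>\<^sub>l\<close> of modulus less than \<open>1\<close> and a perturbation that tends to \<open>0\<close>.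
\<close>

lemma normal_form_iterates_tendsto_0: "(\<lambda>N. (normal_form ^^ N) y) \<longlonglongrightarrow> 0"
proof (rule vec_tendstoI)
  fix l
  show "(\<lambda>N. (normal_form ^^ N) y $ l) \<longlonglongrightarrow> 0 $ l"
  proof (induction l rule: less_card_induct)
    case (less l)
    have "(\<lambda>N. mono_pow ((normal_form ^^ N) y) q) \<longlonglongrightarrow> 0" if q: "q \<in> sub_resonances \<beta> l" for q
    proof -
      have tri: "q $ k = 0" if "l \<le> k" for k
        by (rule sub_resonance_triangular[OF \<beta>_pos \<beta>_less \<beta>_ord q that])
      obtain k where k: "q $ k \<noteq> 0" using q by (auto simp: sub_resonances_def vec_eq_iff)
      have "(\<lambda>N. (normal_form ^^ N) y $ i ^ q $ i) \<longlonglongrightarrow> (0::complex) ^ q $ i" for i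
      proof (cases "i < l")
        case True
        then show ?thesis using less[OF True] by (intro tendsto_power) simp
      qed (use tri[of i] in simp)
      then have "(\<lambda>N. mono_pow ((normal_form ^^ N) y) q) \<longlonglongrightarrow> (\<Prod>i\<in>UNIV. (0::complex) ^ q $ i)"
        unfolding mono_pow_def by (intro tendsto_prod)
      moreover have "(\<Prod>i\<in>UNIV. (0::complex) ^ q $ i) = 0"
        using k by (intro prod_zero) (auto intro!: exI[of _ k])
      ultimately show ?thesis by simp
    qed
    then have "(\<lambda>N. \<Sum>q\<in>sub_resonances \<beta> l. c l q * mono_pow ((normal_form ^^ N) y) q)
        \<longlonglongrightarrow> (\<Sum>q\<in>sub_resonances \<beta> l. c l q * 0)"
      by (intro tendsto_sum tendsto_mult tendsto_const)
    then have lim: "(\<lambda>N. \<Sum>q\<in>sub_resonances \<beta> l. c l q * mono_pow ((normal_form ^^ N) y) q) \<longlonglongrightarrow> 0"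
      by simp
    have "(normal_form ^^ Suc N) y $ l = \<beta> $ l * (normal_form ^^ N) y $ l
        + (\<Sum>q\<in>sub_resonances \<beta> l. c l q * mono_pow ((normal_form ^^ N) y) q)" for N
      by (simp add: normal_form_def[of "(normal_form ^^ N) y"])
    from linear_recursion_tendsto_0[where u = "\<lambda>N. (normal_form ^^ N) y $ l", OF this lim \<beta>_less]
    have "(\<lambda>N. (normal_form ^^ N) y $ l) \<longlonglongrightarrow> 0" .
    then show ?case by simp
  qed
qed

end

lemma vanishes_at_0:
  assumes f: "vanishes wt s f" and s: "s > 0"
  shows "f 0 = 0"
proof -
  obtain C where C: "\<forall>\<^sub>F t in at_right 0. \<forall>z\<in>weighted_box wt t. cmod (f z) \<le> C * t ^ s"
    using f by (rule vanishesE)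
  have ev: "\<forall>\<^sub>F t in at_right 0. cmod (f 0) \<le> C * t ^ s"
    using C eventually_at_right_less[of 0] by eventually_elim (auto simp: weighted_box_def)
  have "((\<lambda>t. C * t ^ s) \<longlongrightarrow> C * 0 ^ s) (at_right 0)" by (intro tendsto_intros)
  from tendsto_le[OF _ this tendsto_const ev] have "cmod (f 0) \<le> C * 0 ^ s" by simp
  then show ?thesis using s by (simp add: zero_power)
qed

text \<open>
  If the coordinates of \<open>v\<close> before \<open>l\<close> are zero then \<open>t\<^bsup>wt l\<^esup> v\<close> lies in a box of size comparable to
  \<open>t\<close>, because the other coordinates have weight at most \<open>wt l\<close>. There \<open>h\<close> is \<open>O(t\<^bsup>wt l + 1\<^esup>)\<close>, of smaller
  order than the displacement.
\<close>

lemma differential_vanishes: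
  assumes h: "entire h" "vanishes wt (wt l + 1) h" and v: "\<And>i. i < l \<Longrightarrow> v $ i = 0"
  shows "differential h 0 v = 0"
proof -
  have h0: "h 0 = 0" by (rule vanishes_at_0[OF h(2)]) simp
  obtain C where C: "\<forall>\<^sub>F t in at_right 0. \<forall>z\<in>weighted_box wt t. cmod (h z) \<le> C * t ^ (wt l + 1)"
    using h(2) by (rule vanishesE)
  \<comment> \<open>Rescaling makes all coordinates at most \<open>1\<close> in modulus, so that \<open>t\<^bsup>wt l\<^esup> u\<close> lies in the box of size \<open>t\<close>.\<close>
  define u where "u = of_real (inverse (1 + norm v)) *s v"
  have pos: "1 + norm v > 0" by (rule add_pos_nonneg) auto
  have u1: "cmod (u $ i) \<le> 1" for i
    using norm_vec_nth_le[of v i] pos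
    by (simp add: u_def norm_mult norm_inverse norm_divide field_simps del: of_real_add)
  have u0: "u $ i = 0" if "i < l" for i using v[OF that] by (simp add: u_def)
  have "((\<lambda>s. (h (s *s u) - h 0) / s) \<longlongrightarrow> differential h 0 u) (at 0)"
    using entire_along_line[OF h(1), of 0 u 0] by (simp add: has_field_derivative_iff)
  moreover have "filterlim (\<lambda>t. of_real (t ^ wt l)) (at (0::complex)) (at_right (0::real))"
  proof (rule filterlim_atI)
    have "((\<lambda>t. of_real (t ^ wt l)) \<longlongrightarrow> (of_real (0 ^ wt l) :: complex)) (at_right (0::real))"
      by (intro tendsto_intros)
    then show "((\<lambda>t. of_real (t ^ wt l)) \<longlongrightarrow> (0 :: complex)) (at_right (0::real))"
      using wt_pos[of l] by (simp add: zero_power)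
    show "\<forall>\<^sub>F t in at_right (0::real). of_real (t ^ wt l) \<noteq> (0 :: complex)"
      using eventually_at_right_less[of 0] by eventually_elim simp
  qed
  ultimately have lim: "((\<lambda>t. (h (of_real (t ^ wt l) *s u) - h 0) / of_real (t ^ wt l)) \<longlongrightarrow> differential h 0 u) (at_right 0)"
    by (rule filterlim_compose)
  have "\<forall>\<^sub>F t in at_right (0::real). t < 1" by (intro eventually_at_rightI[of 0 1]) auto
  with C eventually_at_right_less[of 0]
  have ev: "\<forall>\<^sub>F t in at_right 0. cmod ((h (of_real (t ^ wt l) *s u) - h 0) / of_real (t ^ wt l)) \<le> C * t"
  proof eventually_elim
    case (elim t)
    have "cmod ((of_real (t ^ wt l) *s u) $ i) \<le> t ^ wt i" for i
    proof (cases "i < l")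
      case False
      have "cmod ((of_real (t ^ wt l) *s u) $ i) \<le> t ^ wt l * 1"
        using elim u1[of i] by (simp add: norm_mult norm_power mult_left_le)
      also have "\<dots> \<le> t ^ wt i" using elim wt_antimono[of l i] False by (simp add: power_decreasing)
      finally show ?thesis .
    qed (use u0 elim in simp)
    then have "cmod (h (of_real (t ^ wt l) *s u)) \<le> C * t ^ (wt l + 1)"
      using elim by (simp add: weighted_box_def)
    then show ?case using elim by (simp add: h0 norm_divide norm_power divide_le_eq mult_ac)
  qed
  have "((\<lambda>t. C * t) \<longlongrightarrow> C * 0) (at_right 0)" by (intro tendsto_intros)
  then have "((\<lambda>t. C * t) \<longlongrightarrow> 0) (at_right 0)" by simp
  from tendsto_unique[OF _ Lim_null_comparison[OF ev this] lim] have "differential h 0 u = 0" by simp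
  then show ?thesis using pos by (simp add: u_def entire_differential(2)[OF h(1)] del: of_real_add)
qed

text \<open>
  Write \<open>P\<close> for the normal form. Iterating \<open>\<Psi> \<circ> \<gamma> = P \<circ> \<Psi>\<close> reduces each property of \<open>\<Psi>\<close> to its
  local version at \<open>0\<close>. Injectivity and injectivity of the differential are pulled back along \<open>\<gamma>\<^sup>N\<close>. For surjectivity, \<open>P\<^sup>N y\<close> enters the
  neighbourhood of \<open>0\<close> covered by \<open>\<Psi>\<close>, say \<open>P\<^sup>N y = \<Psi> (\<gamma>\<^sup>N x')\<close>; this equals \<open>P\<^sup>N (\<Psi> x')\<close>, and
  injectivity of \<open>P\<close> gives \<open>y = \<Psi> x'\<close>.
\<close>

theorem conjugate_to_subresonant:
  assumes bij: "bij \<gamma>" and inv_entire: "\<And>l. entire (\<lambda>z. inv \<gamma> z $ l)"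
  shows "\<exists>\<phi>. biholomorphism \<phi> \<and> inv \<phi> \<circ> \<gamma> \<circ> \<phi> \<in> subresonant_group (max_resonance_length \<beta>) \<beta>"
proof -
  obtain \<Psi> c where \<Psi>: "\<And>l. entire (\<lambda>z. \<Psi> z $ l)" "\<And>l. vanishes wt (wt l + 1) (\<lambda>z. \<Psi> z $ l - z $ l)"
    and eq: "\<And>l z. \<Psi> (\<gamma> z) $ l = \<beta> $ l * \<Psi> z $ l + (\<Sum>q\<in>sub_resonances \<beta> l. c l q * mono_pow (\<Psi> z) q)"
    by (rule semiconjugacy) blast
  have semi: "\<Psi> (\<gamma> z) = normal_form c (\<Psi> z)" for z by (simp add: vec_eq_iff normal_form_def eq)
  note semiN = funpow_commute[of \<Psi> \<gamma> "normal_form c", OF semi]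
  let ?D = "total_differential \<Psi>"
  have \<Psi>0: "\<Psi> 0 = 0" using vanishes_at_0[OF \<Psi>(2)] by (simp add: vec_eq_iff)
  have lin: "linear (?D x)" for x
    by (rule has_derivative_linear[OF total_differential(1)[OF \<Psi>(1)]])
  have inj0: "v = 0" if v: "?D 0 v = 0" for v
  proof -
    have "v $ l = 0" for l
    proof (induction l rule: less_card_induct)
      case (less l)
      have "differential (\<lambda>z. \<Psi> z $ l - z $ l) 0 v = 0"
        by (rule differential_vanishes[OF _ \<Psi>(2) less]) (intro entire_diff \<Psi>(1) entire_coord)
      moreover have "differential (\<lambda>z. z $ l) 0 v = v $ l"
        using frechet_derivative_at[OF bounded_linear_imp_has_derivative[OF bounded_linear_vec_nth]] by metis
      ultimately have "differential (\<lambda>z. \<Psi> z $ l) 0 v = v $ l"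
        using differential_diff[OF \<Psi>(1)[of l] entire_coord[of l], of 0 v] by simp
      then show ?case using v by (auto simp: total_differential_def vec_eq_iff)
    qed
    then show ?thesis by (simp add: vec_eq_iff)
  qed
  have inj_lin: "inj (?D x)" if "\<And>v. ?D x v = 0 \<Longrightarrow> v = 0" for x
    using that linear_injective_0[OF lin] by blast
  have "inj (?D 0)" by (rule inj_lin) (rule inj0)
  from linear_injective_isomorphism[OF lin this]
  obtain g0 where g0: "linear g0" "\<And>v. g0 (?D 0 v) = v" "\<And>v. ?D 0 (g0 v) = v" by auto
  have bl_g0: "bounded_linear g0" using g0(1) by (simp add: linear_conv_bounded_linear)
  obtain B where B: "B > 0" "\<And>v. norm v \<le> B * norm (?D 0 v)"
  proof -
    obtain B where "B > 0" "\<And>x. norm (g0 x) \<le> norm x * B" using bounded_linear.pos_bounded[OF bl_g0] by blast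
    then show ?thesis using that[of B] g0(2) by (metis mult.commute)
  qed
  note cont = total_differential_continuous[OF \<Psi>(1)]
  obtain d where d: "d > 0" and dD: "\<And>x v. norm x < d \<Longrightarrow> norm (?D x v - ?D 0 v) \<le> (1 / (2 * B)) * norm v"
    using cont[of "1 / (2 * B)"] B(1) by auto
  have inj_near: "v = 0" if x: "norm x < d" and v: "?D x v = 0" for x v
  proof -
    have "norm v \<le> B * norm (?D 0 v)" by (rule B)
    also have "\<dots> \<le> B * ((1 / (2 * B)) * norm v)" using dD[OF x, of v] v B(1) by (intro mult_left_mono) auto
    also have "\<dots> = norm v / 2" using B(1) by simp
    finally show ?thesis by simp
  qed
  have into: "\<exists>N. (\<gamma> ^^ N) ` K \<subseteq> ball 0 r" if "compact K" "r > 0" for K r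
    using \<gamma>_contr[OF that(1), of "ball 0 r"] that(2) unfolding eventually_sequentially by auto
  have bijN: "bij (\<gamma> ^^ N)" for N using bij_betw_funpow[of \<gamma> UNIV] bij by simp
  have D\<gamma>: "v = 0" if v: "total_differential (\<gamma> ^^ N) x v = 0" for x v N
  proof -
    have id: "(inv \<gamma> ^^ N) ((\<gamma> ^^ N) z) = z" for z
    proof (induction N)
      case (Suc N)
      have "(inv \<gamma> ^^ Suc N) ((\<gamma> ^^ Suc N) z) = (inv \<gamma> ^^ N) (inv \<gamma> (\<gamma> ((\<gamma> ^^ N) z)))"
        by (simp add: funpow_swap1)
      then show ?case using Suc by (simp add: inv_f_f[OF bij_is_inj[OF bij]])
    qed simp
    have "total_differential (\<lambda>z. (inv \<gamma> ^^ N) ((\<gamma> ^^ N) z)) x v = 0"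
      by (simp add: total_differential_compose[OF entire_funpow[OF inv_entire] entire_funpow[OF \<gamma>_entire]] v
          total_differential_0[OF entire_funpow[OF inv_entire]])
    moreover have "total_differential (\<lambda>z::'n cvec. z) x = (\<lambda>v. v)"
      by (rule total_differential_unique) (auto intro!: derivative_eq_intros)
    ultimately show ?thesis by (simp add: id)
  qed
  have D_inj: "v = 0" if v: "?D x v = 0" for x v
  proof -
    obtain N where N: "(\<gamma> ^^ N) ` {x} \<subseteq> ball 0 d" using into[of "{x}" d] d by auto
    have "(\<lambda>z. \<Psi> ((\<gamma> ^^ N) z)) = (\<lambda>z. (normal_form c ^^ N) (\<Psi> z))" using semiN by blast
    then have "?D ((\<gamma> ^^ N) x) (total_differential (\<gamma> ^^ N) x v)
        = total_differential (normal_form c ^^ N) (\<Psi> x) (?D x v)"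
      using total_differential_compose[OF \<Psi>(1) entire_funpow[OF \<gamma>_entire, of N], of x v]
        total_differential_compose[OF entire_funpow[OF normal_form_entire, of N c] \<Psi>(1), of x v] by simp
    then have "?D ((\<gamma> ^^ N) x) (total_differential (\<gamma> ^^ N) x v) = 0"
      by (simp add: v total_differential_0[OF entire_funpow[OF normal_form_entire]])
    moreover have "norm ((\<gamma> ^^ N) x) < d" using N by simp
    ultimately have "total_differential (\<gamma> ^^ N) x v = 0" using inj_near by blast
    then show ?thesis by (rule D\<gamma>)
  qed
  have contin: "continuous_on UNIV \<Psi>"
    by (intro continuous_at_imp_continuous_on ballI has_derivative_continuous[OF total_differential(1)] \<Psi>(1))
  obtain r where r: "r > 0" "inj_on \<Psi> (ball 0 r)"
  proof (rule has_derivative_locally_injective[of 0 UNIV g0 ?D \<Psi>])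
    show "\<exists>d>0. \<forall>x. dist 0 x < d \<longrightarrow> onorm (\<lambda>v. ?D x v - ?D 0 v) < e" if e: "e > 0" for e
    proof -
      obtain d where "d > 0" and dD: "\<And>x v. norm x < d \<Longrightarrow> norm (?D x v - ?D 0 v) \<le> (e / 2) * norm v"
        using cont[of "e / 2"] e by auto
      moreover have "onorm (\<lambda>v. ?D x v - ?D 0 v) < e" if "norm x < d" for x
      proof -
        have "onorm (\<lambda>v. ?D x v - ?D 0 v) \<le> e / 2" using dD[OF that] by (rule onorm_le)
        then show ?thesis using \<open>e > 0\<close> by linarith
      qed
      ultimately show ?thesis by auto
    qed
  qed (use g0 bl_g0 total_differential(1)[OF \<Psi>(1)] in \<open>auto simp: fun_eq_iff\<close>)
  have inj: "inj \<Psi>"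
  proof (rule injI)
    fix x y assume xy: "\<Psi> x = \<Psi> y"
    obtain N where "(\<gamma> ^^ N) ` {x, y} \<subseteq> ball 0 r" using into[of "{x, y}" r] r by auto
    moreover have "\<Psi> ((\<gamma> ^^ N) x) = \<Psi> ((\<gamma> ^^ N) y)" by (simp add: semiN xy)
    ultimately have "(\<gamma> ^^ N) x = (\<gamma> ^^ N) y" using r(2) by (auto dest: inj_onD)
    then show "x = y" using bijN by (metis bij_is_inj injD)
  qed
  have surj: "y \<in> range \<Psi>" for y
  proof -
    have "\<Psi> 0 \<in> interior (\<Psi> ` UNIV)"
      by (rule sussmann_open_mapping[OF open_UNIV contin UNIV_I total_differential(1)[OF \<Psi>(1)] bl_g0])
         (use g0 in \<open>auto simp: fun_eq_iff\<close>)
    then obtain U where U: "open U" "0 \<in> U" "U \<subseteq> range \<Psi>" unfolding \<Psi>0 interior_def by auto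
    have "\<forall>\<^sub>F N in sequentially. (normal_form c ^^ N) y \<in> U"
      using topological_tendstoD[OF normal_form_iterates_tendsto_0 U(1,2)] .
    then obtain N where "(normal_form c ^^ N) y \<in> U" unfolding eventually_sequentially by blast
    then obtain x where "(normal_form c ^^ N) y = \<Psi> x" using U(3) by blast
    moreover obtain x' where "x = (\<gamma> ^^ N) x'" using bijN by (metis bij_pointE)
    ultimately have "(normal_form c ^^ N) y = (normal_form c ^^ N) (\<Psi> x')" by (simp add: semiN)
    moreover have "inj (normal_form c ^^ N)" using inj_normal_form by (rule inj_fn)
    ultimately show ?thesis by (metis injD rangeI)
  qed
  have bij\<Psi>: "bij \<Psi>" using inj surj by (auto simp: bij_def)
  let ?\<phi> = "inv \<Psi>"
  have "holomorphic_map ?\<phi>"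
    unfolding holomorphic_map_def
  proof
    fix y
    obtain x where x: "y = \<Psi> x" using surj by blast
    have "inj (?D x)" by (rule inj_lin) (rule D_inj)
    from linear_injective_isomorphism[OF lin this]
    obtain g where g: "linear g" "\<And>v. g (?D x v) = v" "\<And>v. ?D x (g v) = v" by auto
    have "(?\<phi> has_derivative g) (at (\<Psi> x))"
      by (rule has_derivative_inverse_strong[OF open_UNIV UNIV_I contin _ total_differential(1)[OF \<Psi>(1)]])
         (use inj g in \<open>auto simp: fun_eq_iff\<close>)
    moreover have "g (a *s v) = a *s g v" for a v
      using g(2)[of "a *s g v"] by (simp add: total_differential(2)[OF \<Psi>(1)] g(3))
    then have "Vector_Spaces.linear (*s) (*s) g"
      unfolding Vector_Spaces.linear_iff using g(1) by (auto simp: linear_add intro: vec.vector_space_axioms)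
    ultimately show "\<exists>f'. Vector_Spaces.linear (*s) (*s) f' \<and> (?\<phi> has_derivative f') (at y)" unfolding x by blast
  qed
  moreover have "holomorphic_map \<Psi>" using \<Psi>(1) by (simp add: holomorphic_map_iff_entire)
  moreover have inv_inv: "inv ?\<phi> = \<Psi>" by (rule inv_inv_eq[OF bij\<Psi>])
  ultimately have "biholomorphism ?\<phi>"
    unfolding biholomorphism_def by (simp add: bij_imp_bij_inv[OF bij\<Psi>])
  moreover have "inv ?\<phi> \<circ> \<gamma> \<circ> ?\<phi> = normal_form c"
    unfolding inv_inv by (simp add: fun_eq_iff semi surj_f_inv_f[OF bij_is_surj[OF bij\<Psi>]])
  moreover have "normal_form c \<in> subresonant_group (max_resonance_length \<beta>) \<beta>"
  proof -
    have "\<beta> $ j \<noteq> 0" for j using \<beta>_pos[of j] by auto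
    then show ?thesis
      unfolding subresonant_group_max_resonance_length[OF \<beta>_pos \<beta>_less]
      by (intro CollectI exI[of _ "\<lambda>j. \<beta> $ j"] exI[of _ c]) (simp add: normal_form_def)
  qed
  ultimately show ?thesis by metis
qed

end

section \<open>Triangular form and eigenvalues of the differential\<close>

lemma permutes_le_imp_id:
  fixes p :: "'n::{finite,linorder} \<Rightarrow> 'n"
  assumes p: "p permutes UNIV" and le: "\<And>i. p i \<le> i"
  shows "p = id"
proof
  fix l
  show "p l = id l"
  proof (induction l rule: less_card_induct)
    case (less l)
    show ?case
    proof (cases "p l < l")
      case True
      then have "p (p l) = p l" using less by simp
      then show ?thesis using permutes_inj[OF p] by (simp add: inj_eq)
    qed (use le[of l] in auto)
  qed
qed

lemma det_lower_triangular:
  fixes L :: "('n::{finite,linorder} cvec, 'n) vec"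
  assumes L: "\<And>i j. i < j \<Longrightarrow> L $ i $ j = 0"
  shows "det L = (\<Prod>i\<in>UNIV. L $ i $ i)"
proof -
  have "det L = (\<Sum>p\<in>{id}. of_int (sign p) * (\<Prod>i\<in>UNIV. L $ i $ p i))"
    unfolding det_def
  proof (rule sum.mono_neutral_right)
    show "\<forall>p\<in>{p. p permutes UNIV} - {id}. of_int (sign p) * (\<Prod>i\<in>UNIV. L $ i $ p i) = 0"
    proof
      fix p :: "'n \<Rightarrow> 'n" assume "p \<in> {p. p permutes UNIV} - {id}"
      then obtain i where "i < p i" using permutes_le_imp_id[of p] by (auto simp flip: not_le)
      then have "(\<Prod>i\<in>UNIV. L $ i $ p i) = 0" using L by (intro prod_zero) auto
      then show "of_int (sign p) * (\<Prod>i\<in>UNIV. L $ i $ p i) = 0" by simp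
    qed
  qed (auto simp: finite_permutations permutes_id)
  then show ?thesis by (simp add: sign_id)
qed

lemma det_zero_imp_kernel:
  fixes B :: "complex^'n^'n"
  assumes "det B = 0"
  obtains v where "v \<noteq> 0" "B *v v = 0"
proof -
  have "\<not> (\<exists>C. C ** B = mat 1)" using assms invertible_det_nz[of B] invertible_left_inverse[of B] by blast
  then show ?thesis using that unfolding matrix_left_invertible_ker by blast
qed

lemma mat_mult_left: "(mat x ** B) $ i $ j = x * B $ i $ j" for B :: "complex^'n^'n"
  by (simp add: matrix_matrix_mult_def mat_def if_distrib[of "\<lambda>y. y * _"] cong: if_cong)

lemma mat_mult_right: "(B ** mat x) $ i $ j = x * B $ i $ j" for B :: "complex^'n^'n"
  by (simp add: matrix_matrix_mult_def mat_def if_distrib[of "\<lambda>y. _ * y"] cong: if_cong)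

lemma matrix_diff_ldistrib: "B ** (C - D) = B ** C - B ** D" for B C D :: "complex^'n^'n"
  by (simp add: vec_eq_iff matrix_matrix_mult_def right_diff_distrib sum_subtractf)

lemma matrix_diff_rdistrib: "(C - D) ** B = C ** B - D ** B" for B C D :: "complex^'n^'n"
  by (simp add: vec_eq_iff matrix_matrix_mult_def left_diff_distrib sum_subtractf)

lemma det_similar:
  fixes A M N :: "complex^'n^'n"
  assumes MN: "M ** N = mat 1"
  shows "det (mat x - M ** A ** N) = det (mat x - A)"
proof -
  have "M ** mat x ** N = mat x ** (M ** N)"
    by (metis (no_types) matrix_mul_assoc mat_mult_left mat_mult_right vec_eq_iff)
  then have "mat x - M ** A ** N = M ** (mat x - A) ** N"
    by (simp add: MN matrix_diff_ldistrib matrix_diff_rdistrib)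
  moreover have "det M * det N = 1" using MN by (metis det_I det_mul)
  ultimately show ?thesis by (simp add: det_mul mult_ac)
qed

text \<open>
  To identify a row of \<open>Y T Y\<inverse>\<close> it suffices to express the row of \<open>Y T\<close> in the rows of \<open>Y\<close>.
\<close>

lemma conjugated_row:
  fixes Y T Z :: "complex^'n^'n"
  assumes YZ: "Y ** Z = mat 1" and v: "\<And>j. (\<Sum>k\<in>UNIV. v k * Y $ k $ j) = (Y ** T) $ i $ j"
  shows "(Y ** T ** Z) $ i $ j = v j"
proof -
  have "(Y ** T ** Z) $ i $ j = (\<Sum>l\<in>UNIV. (Y ** T) $ i $ l * Z $ l $ j)"
    by (simp add: matrix_matrix_mult_def)
  also have "\<dots> = (\<Sum>l\<in>UNIV. \<Sum>k\<in>UNIV. v k * (Y $ k $ l * Z $ l $ j))"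
    unfolding v[symmetric] sum_distrib_right by (simp add: mult_ac)
  also have "\<dots> = (\<Sum>k\<in>UNIV. v k * (Y ** Z) $ k $ j)"
    by (subst sum.swap) (simp add: matrix_matrix_mult_def sum_distrib_left)
  also have "\<dots> = v j" by (simp add: YZ mat_def if_distrib[of "\<lambda>y. _ * y"] cong: if_cong)
  finally show ?thesis .
qed

text \<open>
  If the rows of \<open>T\<close> before \<open>b\<close> are already triangular then \<open>x - T\<close> factors into a lower triangular
  matrix with determinant \<open>\<Prod>\<^sub>i\<^sub><\<^sub>b (x - \<beta>\<^sub>i)\<close> and the matrix \<open>R x\<close> obtained from \<open>x - T\<close> by replacing the
  rows before \<open>b\<close> by unit vectors. Cancelling the known factors for generic \<open>x\<close> and passing to the
  limit leaves \<open>det (R x) = \<Prod>\<^sub>i\<^sub>\<ge>\<^sub>b (x - \<beta>\<^sub>i)\<close> also at \<open>x = \<beta>\<^sub>b\<close>, where it vanishes.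
\<close>

lemma det_block_zero:
  fixes T :: "('n::{finite,linorder} cvec, 'n) vec" and \<beta> :: "'n cvec"
  assumes char: "\<And>x. det (mat x - T) = (\<Prod>j\<in>UNIV. x - \<beta> $ j)"
    and lower: "\<And>i j. i < b \<Longrightarrow> i < j \<Longrightarrow> T $ i $ j = 0" and diag: "\<And>i. i < b \<Longrightarrow> T $ i $ i = \<beta> $ i"
  shows "det (\<chi> i. if i < b then axis i 1 else (mat (\<beta> $ b) - T) $ i) = 0"
proof -
  define R where "R x = (\<chi> i. if i < b then axis i 1 else (mat x - T) $ i)" for x
  define L where "L x = (\<chi> i. if i < b then (mat x - T) $ i else axis i 1)" for x
  have LR: "mat x - T = L x ** R x" for x
  proof -
    have "(\<Sum>k\<in>UNIV. L x $ i $ k * R x $ k $ j) = (mat x - T) $ i $ j" for i j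
    proof (cases "i < b")
      case True
      have "L x $ i $ k * R x $ k $ j = (if k = j then (mat x - T) $ i $ j else 0)" for k
        using True lower[OF True, of k] by (auto simp: L_def R_def axis_def mat_def)
      then show ?thesis by simp
    next
      case False
      have "L x $ i $ k * R x $ k $ j = (if k = i then (mat x - T) $ i $ j else 0)" for k
        using False by (auto simp: L_def R_def axis_def)
      then show ?thesis by simp
    qed
    then show ?thesis by (simp add: vec_eq_iff matrix_matrix_mult_def)
  qed
  have detL: "det (L x) = (\<Prod>i\<in>UNIV. if i < b then x - \<beta> $ i else 1)" for x
  proof -
    have "det (L x) = (\<Prod>i\<in>UNIV. L x $ i $ i)"
      by (rule det_lower_triangular) (auto simp: L_def lower mat_def axis_def)
    also have "\<dots> = (\<Prod>i\<in>UNIV. if i < b then x - \<beta> $ i else 1)"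
      by (intro prod.cong) (auto simp: L_def diag mat_def axis_def)
    finally show ?thesis .
  qed
  let ?q = "\<lambda>x. \<Prod>i\<in>UNIV. if i < b then 1 else x - \<beta> $ i"
  have prod: "(\<Prod>i\<in>UNIV. if i < b then x - \<beta> $ i else 1) * ?q x = (\<Prod>j\<in>UNIV. x - \<beta> $ j)" for x
    unfolding prod.distrib[symmetric] by (intro prod.cong) auto
  have "\<forall>\<^sub>F x in at (\<beta> $ b). \<forall>i. x \<noteq> \<beta> $ i"
    by (intro eventually_all_finite eventually_neq_at_within)
  then have ev: "\<forall>\<^sub>F x in at (\<beta> $ b). det (R x) = ?q x"
  proof eventually_elim
    case (elim x)
    have "(\<Prod>i\<in>UNIV. if i < b then x - \<beta> $ i else 1) \<noteq> 0" using elim by simp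
    moreover have "(\<Prod>i\<in>UNIV. if i < b then x - \<beta> $ i else 1) * det (R x)
        = (\<Prod>i\<in>UNIV. if i < b then x - \<beta> $ i else 1) * ?q x"
      using char[of x] unfolding LR det_mul detL prod .
    ultimately show ?case by simp
  qed
  have entry: "((\<lambda>x. R x $ i $ j) \<longlongrightarrow> R a $ i $ j) (at a)" for i j a
    by (cases "i < b") (auto simp: R_def mat_def intro!: tendsto_intros)
  have "((\<lambda>x. det (R x)) \<longlongrightarrow> det (R (\<beta> $ b))) (at (\<beta> $ b))"
    unfolding det_def by (intro tendsto_sum tendsto_mult tendsto_const tendsto_prod entry)
  moreover have "(?q \<longlongrightarrow> ?q (\<beta> $ b)) (at (\<beta> $ b))"
    by (intro tendsto_prod) (auto intro!: tendsto_intros)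
  then have "((\<lambda>x. det (R x)) \<longlongrightarrow> ?q (\<beta> $ b)) (at (\<beta> $ b))"
    using tendsto_cong[OF ev] by blast
  ultimately have "det (R (\<beta> $ b)) = ?q (\<beta> $ b)" by (rule LIM_unique)
  also have "\<dots> = 0" by (intro prod_zero) (auto intro!: exI[of _ b])
  finally show ?thesis unfolding R_def .
qed

text \<open>
  The rows of \<open>M\<close> are built in order. A vector in the left kernel of the singular matrix of
  \<open>det_block_zero\<close> is, after its entries before \<open>b\<close> are deleted, a left eigenvector for \<open>\<beta>\<^sub>b\<close> modulo the
  rows already found; it becomes the \<open>b\<close>-th row of the basis. Working from left to right in the given
  order is what puts the eigenvalues on the diagonal in that order.
\<close>

theorem triangularize:
  fixes A :: "('n::{finite,linorder} cvec, 'n) vec" and \<beta> :: "'n cvec"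
  assumes char: "\<And>x. det (mat x - A) = (\<Prod>j\<in>UNIV. x - \<beta> $ j)"
  obtains M N where "M ** N = mat 1" "N ** M = mat 1"
    "\<And>i j. i < j \<Longrightarrow> (M ** A ** N) $ i $ j = 0" "\<And>i. (M ** A ** N) $ i $ i = \<beta> $ i"
proof -
  have "\<exists>M N. M ** N = mat 1 \<and> N ** M = mat 1 \<and>
     (\<forall>i\<in>S. (\<forall>j>i. (M ** A ** N) $ i $ j = 0) \<and> (M ** A ** N) $ i $ i = \<beta> $ i)"
    if "finite S" "\<forall>i\<in>S. \<forall>j<i. j \<in> S" for S :: "'n set"
    using that
  proof (induction S rule: finite_linorder_max_induct)
    case empty
    show ?case by (intro exI[of _ "mat 1"]) simp
  next
    case (insert b S)
    have S: "S = {i. i < b}" using insert.hyps insert.prems by auto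
    then obtain M N where MN: "M ** N = mat 1" "N ** M = mat 1"
      and low: "\<And>i j. i < b \<Longrightarrow> i < j \<Longrightarrow> (M ** A ** N) $ i $ j = 0"
      and dia: "\<And>i. i < b \<Longrightarrow> (M ** A ** N) $ i $ i = \<beta> $ i"
    proof -
      have "\<forall>i\<in>S. \<forall>j<i. j \<in> S" using S by auto
      from insert.IH[OF this] show ?thesis using that unfolding S by blast
    qed
    define T where "T = M ** A ** N"
    note low = low[folded T_def] and dia = dia[folded T_def]
    have "det (mat x - T) = (\<Prod>j\<in>UNIV. x - \<beta> $ j)" for x
      unfolding T_def det_similar[OF MN(1)] by (rule char)
    from det_block_zero[OF this low dia]
    have "det (\<chi> i. if i < b then axis i 1 else (mat (\<beta> $ b) - T) $ i) = 0" (is "det ?R = 0") .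
    then have "det (transpose ?R) = 0" by (simp add: det_transpose)
    then obtain y where y: "y \<noteq> 0" "transpose ?R *v y = 0" by (rule det_zero_imp_kernel)
    have yR: "(\<Sum>i\<in>UNIV. ?R $ i $ j * y $ i) = 0" for j
      using y(2) by (simp add: vec_eq_iff matrix_vector_mult_def transpose_def)
    define y' where "y' i = (if i < b then 0 else y $ i)" for i
    have y'T: "(\<Sum>i\<in>UNIV. y' i * T $ i $ j) = \<beta> $ b * y' j" if j: "\<not> j < b" for j
    proof -
      have "?R $ i $ j * y $ i = (if i = j then \<beta> $ b * y' j else 0) - y' i * T $ i $ j" for i
        using j by (auto simp: y'_def axis_def mat_def algebra_simps)
      then show ?thesis using yR[of j] by (simp add: sum_subtractf)
    qed
    obtain m where m: "\<not> m < b" "y $ m \<noteq> 0"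
    proof (rule ccontr)
      assume "\<not> thesis"
      then have z: "y $ i = 0" if "\<not> i < b" for i using \<open>\<And>m. \<not> m < b \<Longrightarrow> y $ m \<noteq> 0 \<Longrightarrow> thesis\<close> that by blast
      have "y $ j = 0" for j
      proof (cases "j < b")
        case True
        have "?R $ i $ j * y $ i = (if i = j then y $ j else 0)" for i
          using z[of i] True by (auto simp: axis_def)
        then show ?thesis using yR[of j] by simp
      qed (rule z)
      then show False using y(1) by (simp add: vec_eq_iff)
    qed
    \<comment> \<open>The new row takes the place of \<open>e\<^sub>b\<close>; as \<open>y' m \<noteq> 0\<close>, a basis results if \<open>e\<^sub>b\<close> in turn replaces \<open>e\<^sub>m\<close>.\<close>
    define Y :: "('n cvec, 'n) vec" where
      "Y = (\<chi> i. if i = b then (\<chi> k. y' k) else if i = m then axis b 1 else axis i 1)"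
    have "x = 0" if x: "Y *v x = 0" for x
    proof -
      have row: "(\<Sum>k\<in>UNIV. Y $ i $ k * x $ k) = 0" for i
        using x by (simp add: vec_eq_iff matrix_vector_mult_def)
      have ax: "(\<Sum>k\<in>UNIV. axis i 1 $ k * x $ k) = x $ i" for i
        by (simp add: axis_def if_distrib[of "\<lambda>u. u * _"] cong: if_cong)
      have 1: "x $ i = 0" if "i \<noteq> m" for i
        using row[of i] row[of m] ax[of i] ax[of b] that by (cases "i = b") (auto simp: Y_def)
      have "y' k * x $ k = (if k = m then y $ m * x $ m else 0)" for k
        using 1[of k] m by (auto simp: y'_def)
      then have "y $ m * x $ m = 0" using row[of b] by (simp add: Y_def)
      then show ?thesis using 1 m by (metis mult_eq_0_iff vec_eq_iff zero_index)
    qed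
    then obtain Z where ZY: "Z ** Y = mat 1" using matrix_left_invertible_ker[of Y] by blast
    then have YZ: "Y ** Z = mat 1" by (simp add: matrix_left_right_inverse)
    have Yrow: "Y $ k = axis k 1" if "k < b" for k
      using that m(1) by (auto simp: Y_def)
    have conj: "(Y ** M) ** A ** (N ** Z) = Y ** T ** Z" by (simp add: T_def matrix_mul_assoc)
    have rows: "(Y ** T ** Z) $ i $ j = T $ i $ j" if i: "i < b" for i j
    proof (rule conjugated_row[OF YZ])
      fix j
      have "T $ i $ k * Y $ k $ j = (if k = j then T $ i $ j else 0)" for k
        using low[OF i, of k] Yrow[of k] i by (cases "k < b") (auto simp: axis_def)
      moreover have "(Y ** T) $ i $ j = T $ i $ j"
        by (simp add: matrix_matrix_mult_def Yrow[OF i] axis_def if_distrib[of "\<lambda>u. u * _"] cong: if_cong)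
      ultimately show "(\<Sum>k\<in>UNIV. T $ i $ k * Y $ k $ j) = (Y ** T) $ i $ j" by simp
    qed
    define v where "v j = (if j < b then (Y ** T) $ b $ j else if j = b then \<beta> $ b else 0)" for j
    have rowb: "(Y ** T ** Z) $ b $ j = v j" for j
    proof (rule conjugated_row[OF YZ])
      fix j
      have "v k * Y $ k $ j = (if k = j then (if j < b then (Y ** T) $ b $ j else 0) else 0)
          + (if k = b then \<beta> $ b * y' j else 0)" for k
        using Yrow[of k] by (auto simp: v_def axis_def) (auto simp: Y_def)
      then have "(\<Sum>k\<in>UNIV. v k * Y $ k $ j) = (if j < b then (Y ** T) $ b $ j else 0) + \<beta> $ b * y' j"
        by (simp add: sum.distrib)
      moreover have "(Y ** T) $ b $ j = (\<Sum>i\<in>UNIV. y' i * T $ i $ j)"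
        by (simp add: matrix_matrix_mult_def Y_def)
      ultimately show "(\<Sum>k\<in>UNIV. v k * Y $ k $ j) = (Y ** T) $ b $ j"
        using y'T[of j] by (cases "j < b") (auto simp: y'_def)
    qed
    have "(Y ** M) ** (N ** Z) = mat 1"
      by (metis MN(1) YZ matrix_mul_assoc matrix_mul_rid)
    moreover have "(N ** Z) ** (Y ** M) = mat 1"
      by (metis MN(2) ZY matrix_mul_assoc matrix_mul_rid)
    moreover have "\<forall>i\<in>insert b S. (\<forall>j>i. (Y ** T ** Z) $ i $ j = 0) \<and> (Y ** T ** Z) $ i $ i = \<beta> $ i"
      using low dia by (auto simp: S rows rowb v_def)
    ultimately show ?case unfolding conj[symmetric] by blast
  qed
  from this[of UNIV] show ?thesis using that by auto
qed

lemma poly_charpoly: "poly (charpoly A) x = det (mat x - A)"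
proof -
  have "poly ((mat [:0, 1:] - (\<chi> i j. [:A $ i $ j:])) $ i $ j) x = (mat x - A) $ i $ j" for i j
    by (simp add: mat_def)
  moreover have "poly (of_int k) x = of_int k" for k :: int
    by (cases k) simp_all
  ultimately show ?thesis unfolding charpoly_def det_def by (simp add: poly_sum poly_prod)
qed

lemma entire_matrix_mult: "entire (\<lambda>z. (B *v z) $ l)" for B :: "complex^'n^'n"
  unfolding matrix_vector_mult_def vec_lambda_beta
  by (intro entire_sum entire_mult entire_const entire_coord)

lemma continuous_matrix_mult: "continuous_on S ((*v) B)" for B :: "complex^'n^'n"
  by (intro continuous_at_imp_continuous_on ballI has_derivative_continuous[OF total_differential(1)]
      entire_matrix_mult)

lemma has_derivative_matrix_mult: "((*v) B has_derivative (*v) B) (at z)" for B :: "complex^'n^'n"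
proof -
  have "linear ((*v) B)"
    by (rule linearI)
       (simp_all add: vec_eq_iff matrix_vector_mult_def distrib_left sum.distrib scaleR_sum_right)
  then show ?thesis by (intro bounded_linear_imp_has_derivative) (simp add: linear_conv_bounded_linear)
qed

lemma total_differential_id: "total_differential (\<lambda>z::complex^'n. z) x = (\<lambda>v. v)"
  by (rule total_differential_unique) (auto intro!: derivative_eq_intros)

lemma total_differential_eq_differential_at_0:
  assumes "holomorphic_map \<gamma>"
  shows "total_differential \<gamma> 0 = (*v) (differential_at_0 \<gamma>)"
proof -
  have ent: "\<And>l. entire (\<lambda>z. \<gamma> z $ l)" using assms by (simp add: holomorphic_map_iff_entire)
  obtain f' where f': "Vector_Spaces.linear (*s) (*s) f'" "(\<gamma> has_derivative f') (at 0)"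
    using assms unfolding holomorphic_map_def by blast
  have "differential_at_0 \<gamma> *v v = f' v" for v
    unfolding differential_at_0_def frechet_derivative_at[OF f'(2), symmetric]
    by (rule matrix_works[OF f'(1)])
  then show ?thesis using total_differential_unique[OF ent f'(2)] by auto
qed

lemma eigenvector_of_root:
  fixes A :: "complex^'n^'n"
  assumes "det (mat \<mu> - A) = 0"
  obtains v where "v \<noteq> 0" "A *v v = \<mu> *s v"
proof -
  obtain v where v: "v \<noteq> 0" "(mat \<mu> - A) *v v = 0" using assms by (rule det_zero_imp_kernel)
  have "mat \<mu> *v v = \<mu> *s v"
    by (simp add: vec_eq_iff matrix_vector_mult_def mat_def if_distrib[of "\<lambda>u. u * _"] cong: if_cong)
  then have "A *v v = \<mu> *s v" using v(2) by (simp add: matrix_vector_mult_diff_rdistrib)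
  with v(1) show ?thesis by (rule that)
qed

context
  fixes \<gamma> :: "complex^'n \<Rightarrow> complex^'n"
  assumes ent: "\<And>l. entire (\<lambda>z. \<gamma> z $ l)"
    and contr: "\<And>K U. compact K \<Longrightarrow> open U \<Longrightarrow> 0 \<in> U \<Longrightarrow> \<forall>\<^sub>F N in sequentially. (\<gamma> ^^ N) ` K \<subseteq> U"
begin

text \<open>
  The orbit of \<open>0\<close> converges to \<open>0\<close>, and the limit of an orbit is a fixed point.
\<close>

lemma contraction_fixes_0: "\<gamma> 0 = 0"
proof -
  have lim: "(\<lambda>N. (\<gamma> ^^ N) 0) \<longlonglongrightarrow> 0"
  proof (rule topological_tendstoI)
    fix U :: "(complex^'n) set" assume "open U" "0 \<in> U"
    then have "\<forall>\<^sub>F N in sequentially. (\<gamma> ^^ N) ` {0} \<subseteq> U" by (intro contr) auto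
    then show "\<forall>\<^sub>F N in sequentially. (\<gamma> ^^ N) 0 \<in> U" by simp
  qed
  have "isCont \<gamma> 0" by (rule has_derivative_continuous[OF total_differential(1)[OF ent]])
  from isCont_tendsto_compose[OF this lim] have "(\<lambda>N. (\<gamma> ^^ Suc N) 0) \<longlonglongrightarrow> \<gamma> 0" by simp
  from LIMSEQ_unique[OF this LIMSEQ_Suc[OF lim]] show ?thesis .
qed

context
  fixes \<mu> :: complex and v :: "complex^'n"
  assumes v: "v \<noteq> 0" "total_differential \<gamma> 0 v = \<mu> *s v"
begin

text \<open>
  By Cauchy's inequality the differential of \<open>\<gamma>\<^sup>N\<close> at \<open>0\<close>, which multiplies \<open>v\<close> by \<open>\<mu>\<^sup>N\<close>, is small when
  \<open>\<gamma>\<^sup>N\<close> is small on the ball of radius \<open>norm v\<close>.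
\<close>

lemma eigenvalue_less_1: "cmod \<mu> < 1"
proof -
  obtain l where l: "v $ l \<noteq> 0" using v(1) by (auto simp: vec_eq_iff)
  have \<gamma>N0: "(\<gamma> ^^ N) 0 = 0" for N by (induction N) (simp_all add: contraction_fixes_0)
  have DN: "total_differential (\<gamma> ^^ N) 0 v = \<mu> ^ N *s v" for N
  proof (induction N)
    case 0
    show ?case using total_differential_id[where 'n = 'n] by (simp add: id_def)
  next
    case (Suc N)
    have "total_differential (\<lambda>z. \<gamma> ((\<gamma> ^^ N) z)) 0 v = total_differential \<gamma> 0 (\<mu> ^ N *s v)"
      unfolding total_differential_compose[OF ent entire_funpow[OF ent]] by (simp add: Suc \<gamma>N0)
    also have "\<dots> = \<mu> ^ Suc N *s v"
      by (simp add: total_differential(2)[OF ent] v(2) mult.commute)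
    finally show ?case by (simp add: o_def)
  qed
  obtain N where N: "(\<gamma> ^^ N) ` cball 0 (norm v) \<subseteq> ball 0 (cmod (v $ l) / 2)"
    using contr[of "cball 0 (norm v)" "ball 0 (cmod (v $ l) / 2)"] l
    unfolding eventually_sequentially by auto
  have "cmod (differential (\<lambda>z. (\<gamma> ^^ N) z $ l) 0 v) \<le> cmod (v $ l) / 2"
  proof (rule differential_bound[OF entire_funpow[OF ent]])
    fix u :: "complex^'n" assume "norm (u - 0) \<le> norm v"
    then have "norm ((\<gamma> ^^ N) u) < cmod (v $ l) / 2" using N by (auto simp: image_subset_iff)
    then show "cmod ((\<gamma> ^^ N) u $ l) \<le> cmod (v $ l) / 2"
      using norm_vec_nth_le[of "(\<gamma> ^^ N) u" l] by linarith
  qed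
  moreover have "differential (\<lambda>z. (\<gamma> ^^ N) z $ l) 0 v = \<mu> ^ N * v $ l"
    using DN[of N] by (simp add: total_differential_def vec_eq_iff)
  ultimately have "cmod \<mu> ^ N * cmod (v $ l) \<le> (1/2) * cmod (v $ l)"
    by (simp add: norm_mult norm_power)
  then have "cmod \<mu> ^ N \<le> 1/2" using l by (simp only: mult_le_cancel_right) auto
  then show ?thesis using one_le_power[of "cmod \<mu>" N] by linarith
qed

lemma eigenvalue_nonzero:
  assumes bij: "bij \<gamma>" and inv_ent: "\<And>l. entire (\<lambda>z. inv \<gamma> z $ l)"
  shows "\<mu> \<noteq> 0"
proof -
  have "total_differential (\<lambda>z. inv \<gamma> (\<gamma> z)) 0 v = \<mu> *s total_differential (inv \<gamma>) 0 v"
    unfolding total_differential_compose[OF inv_ent ent]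
    by (simp add: contraction_fixes_0 v(2) total_differential(2)[OF inv_ent])
  then have "v = \<mu> *s total_differential (inv \<gamma>) 0 v"
    by (simp add: inv_f_f[OF bij_is_inj[OF bij]] total_differential_id)
  then show ?thesis using v(1) by auto
qed

end

end

theorem theorem11:
  fixes \<gamma> :: "'n::{finite,linorder} cvec \<Rightarrow> 'n cvec"
    and \<beta> :: "'n cvec" and r :: nat
  assumes "CARD('n) \<ge> 2"
    and "biholomorphic_contraction \<gamma>"
    and "ordered_eigenvalues (differential_at_0 \<gamma>) \<beta>"
    and "r = max_resonance_length \<beta>"
  shows "\<exists>\<phi>. biholomorphism \<phi> \<and> inv \<phi> \<circ> \<gamma> \<circ> \<phi> \<in> subresonant_group r \<beta>"
proof -
  define A where "A = differential_at_0 \<gamma>"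
  have hol: "holomorphic_map \<gamma>" and bij: "bij \<gamma>" and inv_ent: "\<And>l. entire (\<lambda>z. inv \<gamma> z $ l)"
    and contr: "\<And>K U. compact K \<Longrightarrow> open U \<Longrightarrow> 0 \<in> U \<Longrightarrow> \<forall>\<^sub>F N in sequentially. (\<gamma> ^^ N) ` K \<subseteq> U"
    using assms(2) by (auto simp: biholomorphic_contraction_def biholomorphism_def holomorphic_map_iff_entire)
  have ent: "\<And>l. entire (\<lambda>z. \<gamma> z $ l)" using hol by (simp add: holomorphic_map_iff_entire)
  have ord: "\<And>i j. i \<le> j \<Longrightarrow> cmod (\<beta> $ j) \<le> cmod (\<beta> $ i)"
    and cp: "charpoly A = (\<Prod>j\<in>UNIV. [:- (\<beta> $ j), 1:])"
    using assms(3) unfolding ordered_eigenvalues_def A_def by blast+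
  have char: "det (mat x - A) = (\<Prod>j\<in>UNIV. x - \<beta> $ j)" for x
    using poly_charpoly[of A x] unfolding cp by (simp add: poly_prod)
  have \<gamma>0: "\<gamma> 0 = 0" by (rule contraction_fixes_0[OF ent contr])
  have D: "total_differential \<gamma> 0 = (*v) A"
    unfolding A_def by (rule total_differential_eq_differential_at_0[OF hol])
  have D0: "(\<gamma> has_derivative (*v) A) (at 0)" using total_differential(1)[OF ent, of 0] by (simp add: D)
  have eigenvector: "\<exists>v. v \<noteq> 0 \<and> total_differential \<gamma> 0 v = \<beta> $ j *s v" for j
  proof -
    have "det (mat (\<beta> $ j) - A) = 0" unfolding char by (intro prod_zero) auto
    then show ?thesis unfolding D by (rule eigenvector_of_root) blast
  qed
  have less: "cmod (\<beta> $ j) < 1" for j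
    using eigenvector[of j] eigenvalue_less_1[OF ent contr] by blast
  have pos: "0 < cmod (\<beta> $ j)" for j
    using eigenvector[of j] eigenvalue_nonzero[OF ent contr _ _ bij inv_ent] by auto
  obtain M N where MN: "M ** N = mat 1" "N ** M = mat 1"
    and low: "\<And>i j. i < j \<Longrightarrow> (M ** A ** N) $ i $ j = 0" and dia: "\<And>i. (M ** A ** N) $ i $ i = \<beta> $ i"
    by (rule triangularize[OF char]) blast
  have MN_v: "M *v (N *v z) = z" "N *v (M *v z) = z" for z
    by (simp_all add: matrix_vector_mul_assoc MN)
  define g where "g z = M *v \<gamma> (N *v z)" for z
  have gN: "(g ^^ k) z = M *v (\<gamma> ^^ k) (N *v z)" for k z
    by (induction k) (simp_all add: g_def MN_v)
  have g_ent: "entire (\<lambda>z. g z $ l)" for l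
    unfolding g_def by (intro entire_compose[OF entire_matrix_mult] entire_compose[OF ent] entire_matrix_mult)
  interpret triangular_contraction g "M ** A ** N" \<beta>
  proof
    show "entire (\<lambda>z. g z $ l)" for l by (rule g_ent)
    show "g 0 = 0" by (simp add: g_def \<gamma>0)
    have "((\<lambda>z. \<gamma> (N *v z)) has_derivative (\<lambda>v. A *v (N *v v))) (at 0)"
      by (rule has_derivative_compose[OF has_derivative_matrix_mult]) (simp add: D0)
    from has_derivative_compose[OF this has_derivative_matrix_mult]
    show "(g has_derivative (\<lambda>v. (M ** A ** N) *v v)) (at 0)"
      by (simp add: g_def[abs_def] matrix_vector_mul_assoc matrix_mul_assoc)
    fix K U :: "'n cvec set" assume K: "compact K" and U: "open U" "0 \<in> U"
    have "\<forall>\<^sub>F k in sequentially. (\<gamma> ^^ k) ` ((*v) N ` K) \<subseteq> (*v) M -` U"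
    proof (rule contr)
      show "compact ((*v) N ` K)" by (rule compact_continuous_image[OF continuous_matrix_mult K])
      show "open ((*v) M -` U)" by (rule open_vimage[OF U(1) continuous_matrix_mult])
    qed (use U in simp)
    then show "\<forall>\<^sub>F k in sequentially. (g ^^ k) ` K \<subseteq> U"
      by eventually_elim (auto simp: gN)
  qed (use low dia pos less ord in auto)
  have inv_\<gamma>: "inv \<gamma> (\<gamma> z) = z" "\<gamma> (inv \<gamma> z) = z" for z
    using bij by (simp_all add: inv_f_f bij_is_inj surj_f_inv_f bij_is_surj)
  have g_bij: "bij g" and inv_g: "inv g = (\<lambda>z. M *v inv \<gamma> (N *v z))"
  proof -
    have 1: "g \<circ> (\<lambda>z. M *v inv \<gamma> (N *v z)) = id" and 2: "(\<lambda>z. M *v inv \<gamma> (N *v z)) \<circ> g = id"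
      by (auto simp: g_def MN_v inv_\<gamma>)
    show "bij g" by (rule o_bij[OF 2 1])
    show "inv g = (\<lambda>z. M *v inv \<gamma> (N *v z))" by (rule inv_unique_comp[OF 1 2])
  qed
  have "entire (\<lambda>z. inv g z $ l)" for l
    unfolding inv_g by (intro entire_compose[OF entire_matrix_mult] entire_compose[OF inv_ent] entire_matrix_mult)
  from conjugate_to_subresonant[OF g_bij this] obtain \<psi> where
    \<psi>: "biholomorphism \<psi>" "inv \<psi> \<circ> g \<circ> \<psi> \<in> subresonant_group r \<beta>" using assms(4) by blast
  have b\<psi>: "bij \<psi>" and \<psi>_ent: "\<And>l. entire (\<lambda>z. \<psi> z $ l)" and inv\<psi>_ent: "\<And>l. entire (\<lambda>z. inv \<psi> z $ l)"
    using \<psi>(1) by (auto simp: biholomorphism_def holomorphic_map_iff_entire)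
  have inv_\<psi>: "inv \<psi> (\<psi> z) = z" "\<psi> (inv \<psi> z) = z" for z
    using b\<psi> by (simp_all add: inv_f_f bij_is_inj surj_f_inv_f bij_is_surj)
  define \<phi> where "\<phi> z = N *v \<psi> z" for z
  have 1: "\<phi> \<circ> (\<lambda>z. inv \<psi> (M *v z)) = id" and 2: "(\<lambda>z. inv \<psi> (M *v z)) \<circ> \<phi> = id"
    by (auto simp: \<phi>_def MN_v inv_\<psi>)
  have inv_\<phi>: "inv \<phi> = (\<lambda>z. inv \<psi> (M *v z))" by (rule inv_unique_comp[OF 1 2])
  have "biholomorphism \<phi>"
    unfolding biholomorphism_def holomorphic_map_iff_entire inv_\<phi>
  proof (intro conjI allI)
    show "bij \<phi>" by (rule o_bij[OF 2 1])
    show "entire (\<lambda>z. \<phi> z $ l)" for l unfolding \<phi>_def by (intro entire_compose[OF entire_matrix_mult] \<psi>_ent)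
    show "entire (\<lambda>z. inv \<psi> (M *v z) $ l)" for l by (rule entire_compose[OF inv\<psi>_ent entire_matrix_mult])
  qed
  moreover have "inv \<phi> \<circ> \<gamma> \<circ> \<phi> = inv \<psi> \<circ> g \<circ> \<psi>"
    by (simp add: fun_eq_iff inv_\<phi> \<phi>_def g_def)
  ultimately show ?thesis using \<psi>(2) by metis
qed

end
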